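(* Let $X$ be a proper $\mathrm{CAT}(-1)$ space, and let $\Gamma$ be an infinite quasi-convex group of isometries of $X$. There exists an open set $\Omega^{\max}_{\Gamma}\subset \partial_{\infty}^{\max}(X\times X)$ such that: (a) the diagonal action of $\Gamma$ on $(X\times X)\cup \Omega^{\max}_{\Gamma}$ is properly discontinuous and cocompact; (b) $\Omega^{\max}_{\Gamma}$ is the largest open subset of $\partial_{\infty}^{\max}(X\times X)$ where the diagonal action of $\Gamma$ is properly discontinuous.
   Context: Horofunction compactification: for a proper metric space $(Y,d)$ let $C_*(Y)$ be the space of continuous real functions on $Y$ (topology of uniform convergence on compact sets) modulo additive constants, and $\iota\colon Y\to C_*(Y)$, $\iota(y)=[d(y,\cdot)]$. The horofunction compactification $\overline{Y}$ is the closure of $\iota(Y)$ in $C_*(Y)$; its ideal boundary is $\overline{Y}\setminus\iota(Y)$; $Y$ is identified with $\iota(Y)$. Isometries of $Y$ act on $\overline Y$ by homeomorphisms. On $X\times X$ use the metric $d_{\max}((x,y),(x',y'))=\max\{d(x,x'),d(y,y')\}$. Its horofunction compactification is $\overline{X\times X}^{\max}$ with ideal boundary $\partial_\infty^{\max}(X\times X)$. The diagonal action is $\gamma(x,y)=(\gamma x,\gamma y)$, extended to $\overline{X\times X}^{\max}$; $(X\times X)\cup\Omega^{\max}_\Gamma$ has the subspace topology from $\overline{X\times X}^{\max}$. An action of $\Gamma$ on a space $Z$ is properly discontinuous if for every compact $K\subset Z$ the set $\{\gamma\in\Gamma: \gamma K\cap K\neq\emptyset\}$ is finite; it is cocompact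 if there is a compact $K\subset Z$ whose translates cover $Z$. Quasi-convex group: a subset $S\subset X$ is quasi-convex if there is $\varepsilon\ge 0$ such that the union of all geodesic segments of $X$ with endpoints in $S$ is contained in the $\varepsilon$-neighborhood of $S$. A group $\Gamma$ of isometries of $X$ is quasi-convex if it acts properly discontinuously on $X$ and every orbit is a quasi-convex set. *)

theory Defs
  imports "HOL-Analysis.Analysis"
begin

section \<open>Geodesics and CAT(-1) spaces\<close>

definition geodesic_in :: "'b set \<Rightarrow> ('b \<Rightarrow> 'b \<Rightarrow> real) \<Rightarrow> 'b \<Rightarrow> 'b \<Rightarrow> (real \<Rightarrow> 'b) \<Rightarrow> bool" where
  "geodesic_in M d x y c \<longleftrightarrow>
     c ` {0..d x y} \<subseteq> M \<and> c 0 = x \<and> c (d x y) = y \<and>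
     (\<forall>s\<in>{0..d x y}. \<forall>t\<in>{0..d x y}. d (c s) (c t) = \<bar>s - t\<bar>)"

definition geodesic_space :: "'b set \<Rightarrow> ('b \<Rightarrow> 'b \<Rightarrow> real) \<Rightarrow> bool" where
  "geodesic_space M d \<longleftrightarrow> Metric_space M d \<and> (\<forall>x\<in>M. \<forall>y\<in>M. \<exists>c. geodesic_in M d x y c)"

text \<open>The comparison space is the hyperbolic plane of curvature \<open>-1\<close>, in the upper half-plane
  model.\<close>

definition hyp_plane :: "complex set" where
  "hyp_plane = {z. 0 < Im z}"

definition hyp_dist :: "complex \<Rightarrow> complex \<Rightarrow> real" where
  "hyp_dist z w = arcosh (1 + (cmod (z - w))\<^sup>2 / (2 * Im z * Im w))"

text \<open>The CAT(-1) inequality for a geodesic triangle \<open>p, q, r\<close> and a comparison triangle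
  \<open>p', q', r'\<close>. Two distinct sides of a triangle share a vertex, so up to renaming the vertices
  the two points being compared lie on \<open>[p, q]\<close> and \<open>[p, r]\<close>, at distances \<open>s\<close> and \<open>t\<close> from \<open>p\<close>;
  for two points on the same side the inequality is an equality. The third side \<open>[q, r]\<close> does not
  enter, and it exists because the space is geodesic.\<close>

definition CAT_minus1 :: "'b set \<Rightarrow> ('b \<Rightarrow> 'b \<Rightarrow> real) \<Rightarrow> bool" where
  "CAT_minus1 M d \<longleftrightarrow> geodesic_space M d \<and>
     (\<forall>p\<in>M. \<forall>q\<in>M. \<forall>r\<in>M. \<forall>p'\<in>hyp_plane. \<forall>q'\<in>hyp_plane. \<forall>r'\<in>hyp_plane. \<forall>a b a' b'.
        hyp_dist p' q' = d p q \<longrightarrow> hyp_dist q' r' = d q r \<longrightarrow> hyp_dist p' r' = d p r \<longrightarrow>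
        geodesic_in M d p q a \<longrightarrow> geodesic_in M d p r b \<longrightarrow>
        geodesic_in hyp_plane hyp_dist p' q' a' \<longrightarrow> geodesic_in hyp_plane hyp_dist p' r' b' \<longrightarrow>
        (\<forall>s\<in>{0..d p q}. \<forall>t\<in>{0..d p r}. d (a s) (b t) \<le> hyp_dist (a' s) (b' t)))"


section \<open>Group actions\<close>

text \<open>In the next three definitions \<open>T\<close> is the space acted upon, \<open>G\<close> the group and \<open>a\<close> the action.\<close>

definition acts_on :: "'z topology \<Rightarrow> 'g set \<Rightarrow> ('g \<Rightarrow> 'z \<Rightarrow> 'z) \<Rightarrow> bool" where
  "acts_on T G a \<longleftrightarrow> (\<forall>g\<in>G. a g ` topspace T = topspace T)"

definition properly_discontinuous :: "'z topology \<Rightarrow> 'g set \<Rightarrow> ('g \<Rightarrow> 'z \<Rightarrow> 'z) \<Rightarrow> bool" where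
  "properly_discontinuous T G a \<longleftrightarrow> (\<forall>K. compactin T K \<longrightarrow> finite {g\<in>G. a g ` K \<inter> K \<noteq> {}})"

definition cocompact :: "'z topology \<Rightarrow> 'g set \<Rightarrow> ('g \<Rightarrow> 'z \<Rightarrow> 'z) \<Rightarrow> bool" where
  "cocompact T G a \<longleftrightarrow> (\<exists>K. compactin T K \<and> (\<Union>g\<in>G. a g ` K) = topspace T)"

definition isometry_group :: "('a::metric_space \<Rightarrow> 'a) set \<Rightarrow> bool" where
  "isometry_group \<Gamma> \<longleftrightarrow>
     (\<forall>g\<in>\<Gamma>. surj g \<and> (\<forall>x y. dist (g x) (g y) = dist x y)) \<and>
     id \<in> \<Gamma> \<and> (\<forall>g\<in>\<Gamma>. \<forall>h\<in>\<Gamma>. g \<circ> h \<in> \<Gamma>) \<and> (\<forall>g\<in>\<Gamma>. inv g \<in> \<Gamma>)"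

definition quasi_convex :: "'a::metric_space set \<Rightarrow> bool" where
  "quasi_convex S \<longleftrightarrow>
     (\<exists>\<epsilon>\<ge>0. \<forall>x\<in>S. \<forall>y\<in>S. \<forall>c. geodesic_in UNIV dist x y c \<longrightarrow> c ` {0..dist x y} \<subseteq> (\<Union>s\<in>S. cball s \<epsilon>))"

definition quasi_convex_group :: "('a::metric_space \<Rightarrow> 'a) set \<Rightarrow> bool" where
  "quasi_convex_group \<Gamma> \<longleftrightarrow>
     isometry_group \<Gamma> \<and> properly_discontinuous euclidean \<Gamma> (\<lambda>g. g) \<and>
     (\<forall>x. quasi_convex ((\<lambda>g. g x) ` \<Gamma>))"


section \<open>The horofunction compactification\<close>

text \<open>Here \<open>d\<close> is a metric on the whole type \<open>'b\<close>. It is a parameter, rather than \<open>dist\<close>, because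
  the max metric on a product type is not the \<open>dist\<close> of that type.\<close>

definition cont_funs :: "('b \<Rightarrow> 'b \<Rightarrow> real) \<Rightarrow> ('b \<Rightarrow> real) set" where
  "cont_funs d = {f. continuous_map (Metric_space.mtopology UNIV d) euclideanreal f}"

definition compact_open_nhd :: "('b \<Rightarrow> 'b \<Rightarrow> real) \<Rightarrow> ('b \<Rightarrow> real) \<Rightarrow> 'b set \<Rightarrow> real \<Rightarrow> ('b \<Rightarrow> real) set" where
  "compact_open_nhd d f K e = {g \<in> cont_funs d. \<forall>x\<in>K. \<bar>g x - f x\<bar> < e}"

text \<open>The topology of uniform convergence on compact sets.\<close>

definition cont_topology :: "('b \<Rightarrow> 'b \<Rightarrow> real) \<Rightarrow> ('b \<Rightarrow> real) topology" where
  "cont_topology d = topology (\<lambda>U. U \<subseteq> cont_funs d \<and>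
     (\<forall>f\<in>U. \<exists>K e. compactin (Metric_space.mtopology UNIV d) K \<and> 0 < e \<and> compact_open_nhd d f K e \<subseteq> U))"

lemma openin_cont_topology:
  "openin (cont_topology d) U \<longleftrightarrow> U \<subseteq> cont_funs d \<and>
     (\<forall>f\<in>U. \<exists>K e. compactin (Metric_space.mtopology UNIV d) K \<and> 0 < e \<and> compact_open_nhd d f K e \<subseteq> U)"
    (is "_ \<longleftrightarrow> ?P U")
proof -
  have "?P (S \<inter> T)" if S: "?P S" and T: "?P T" for S T
  proof (intro conjI ballI)
    show "S \<inter> T \<subseteq> cont_funs d" using S by blast
    fix f assume f: "f \<in> S \<inter> T"
    obtain K e where 1: "compactin (Metric_space.mtopology UNIV d) K" "0 < e" "compact_open_nhd d f K e \<subseteq> S"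
      using S f by blast
    obtain L e' where 2: "compactin (Metric_space.mtopology UNIV d) L" "0 < e'" "compact_open_nhd d f L e' \<subseteq> T"
      using T f by blast
    have "compact_open_nhd d f (K \<union> L) (min e e') \<subseteq> S \<inter> T"
      using 1(3) 2(3) unfolding compact_open_nhd_def by auto
    then show "\<exists>K e. compactin (Metric_space.mtopology UNIV d) K \<and> 0 < e \<and> compact_open_nhd d f K e \<subseteq> S \<inter> T"
      using 1 2 by (intro exI[of _ "K \<union> L"] exI[of _ "min e e'"]) (simp add: compactin_Un)
  qed
  moreover have "?P (\<Union>\<K>)" if unions: "\<forall>K\<in>\<K>. ?P K" for \<K>
  proof (intro conjI ballI)
    show "\<Union>\<K> \<subseteq> cont_funs d" using unions by blast
    fix f assume "f \<in> \<Union>\<K>"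
    then obtain S where S: "S \<in> \<K>" "f \<in> S" by blast
    then obtain K e where "compactin (Metric_space.mtopology UNIV d) K" "0 < e" "compact_open_nhd d f K e \<subseteq> S"
      using bspec[OF unions S(1)] by blast
    then show "\<exists>K e. compactin (Metric_space.mtopology UNIV d) K \<and> 0 < e \<and> compact_open_nhd d f K e \<subseteq> \<Union>\<K>"
      using S by (intro exI[of _ K] exI[of _ e]) auto
  qed
  ultimately have "istopology ?P"
    unfolding istopology_def by blast
  then show ?thesis
    unfolding cont_topology_def by (simp add: topology_inverse')
qed

lemma topspace_cont_topology [simp]: "topspace (cont_topology d) = cont_funs d"
proof
  have "openin (cont_topology d) (cont_funs d)"
    unfolding openin_cont_topology
    by (intro conjI ballI exI[of _ "{}"] exI[of _ 1]) (auto simp: compact_open_nhd_def)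
  then show "cont_funs d \<subseteq> topspace (cont_topology d)"
    by (rule openin_subset)
  show "topspace (cont_topology d) \<subseteq> cont_funs d"
    using openin_topspace openin_cont_topology by blast
qed

definition mod_const :: "('b \<Rightarrow> real) \<Rightarrow> ('b \<Rightarrow> real) set" where
  "mod_const f = {g. \<exists>c. \<forall>x. g x = f x + c}"

text \<open>The space \<open>C\<^sub>*\<close> of continuous functions modulo additive constants, with the quotient topology;
  its points are the equivalence classes.\<close>

definition cont_mod_const :: "('b \<Rightarrow> 'b \<Rightarrow> real) \<Rightarrow> ('b \<Rightarrow> real) set topology" where
  "cont_mod_const d = topology (\<lambda>U. U \<subseteq> mod_const ` cont_funs d \<and>
     openin (cont_topology d) {f \<in> cont_funs d. mod_const f \<in> U})"

lemma openin_cont_mod_const: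
  "openin (cont_mod_const d) U \<longleftrightarrow> U \<subseteq> mod_const ` cont_funs d \<and>
     openin (cont_topology d) {f \<in> cont_funs d. mod_const f \<in> U}" (is "_ \<longleftrightarrow> ?P U")
proof -
  have "?P (S \<inter> T)" if S: "?P S" and T: "?P T" for S T
  proof -
    have "{f \<in> cont_funs d. mod_const f \<in> S \<inter> T} =
        {f \<in> cont_funs d. mod_const f \<in> S} \<inter> {f \<in> cont_funs d. mod_const f \<in> T}"
      by blast
    moreover have "S \<inter> T \<subseteq> mod_const ` cont_funs d" using S by blast
    ultimately show ?thesis using S T by (simp add: openin_Int del: Int_iff)
  qed
  moreover have "?P (\<Union>\<K>)" if "\<forall>K\<in>\<K>. ?P K" for \<K>
  proof -
    have "{f \<in> cont_funs d. mod_const f \<in> \<Union>\<K>} = (\<Union>K\<in>\<K>. {f \<in> cont_funs d. mod_const f \<in> K})"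
      by blast
    moreover have "openin (cont_topology d) (\<Union>K\<in>\<K>. {f \<in> cont_funs d. mod_const f \<in> K})"
      using that by (intro openin_Union) auto
    ultimately show ?thesis using that by auto
  qed
  ultimately have "istopology ?P"
    unfolding istopology_def by blast
  then show ?thesis
    unfolding cont_mod_const_def by (simp add: topology_inverse')
qed

lemma topspace_cont_mod_const [simp]: "topspace (cont_mod_const d) = mod_const ` cont_funs d"
proof
  have "{f \<in> cont_funs d. mod_const f \<in> mod_const ` cont_funs d} = cont_funs d"
    by blast
  then have "openin (cont_mod_const d) (mod_const ` cont_funs d)"
    using openin_topspace[of "cont_topology d"] by (simp add: openin_cont_mod_const)
  then show "mod_const ` cont_funs d \<subseteq> topspace (cont_mod_const d)"
    by (rule openin_subset)
  show "topspace (cont_mod_const d) \<subseteq> mod_const ` cont_funs d"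
    using openin_topspace openin_cont_mod_const by blast
qed

lemma quotient_map_mod_const: "quotient_map (cont_topology d) (cont_mod_const d) mod_const"
  unfolding quotient_map_def by (simp add: openin_cont_mod_const)

definition horo_embed :: "('b \<Rightarrow> 'b \<Rightarrow> real) \<Rightarrow> 'b \<Rightarrow> ('b \<Rightarrow> real) set" where
  "horo_embed d y = mod_const (\<lambda>x. d y x)"

definition horo_compactification :: "('b \<Rightarrow> 'b \<Rightarrow> real) \<Rightarrow> ('b \<Rightarrow> real) set set" where
  "horo_compactification d = cont_mod_const d closure_of range (horo_embed d)"

definition ideal_boundary :: "('b \<Rightarrow> 'b \<Rightarrow> real) \<Rightarrow> ('b \<Rightarrow> real) set set" where
  "ideal_boundary d = horo_compactification d - range (horo_embed d)"

definition horo_topology :: "('b \<Rightarrow> 'b \<Rightarrow> real) \<Rightarrow> ('b \<Rightarrow> real) set topology" where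
  "horo_topology d = subtopology (cont_mod_const d) (horo_compactification d)"

text \<open>An isometry \<open>g\<close> acts on classes of functions by \<open>[f] \<mapsto> [f \<circ> g\<^sup>-\<^sup>1]\<close>; this is the continuous
  extension of its action on the embedded space.\<close>

definition horo_act :: "('b \<Rightarrow> 'b) \<Rightarrow> ('b \<Rightarrow> real) set \<Rightarrow> ('b \<Rightarrow> real) set" where
  "horo_act g A = (\<lambda>f. f \<circ> inv g) ` A"

lemma horo_act_mod_const: "horo_act g (mod_const f) = mod_const (f \<circ> inv g)" if "bij g"
proof
  show "horo_act g (mod_const f) \<subseteq> mod_const (f \<circ> inv g)"
    by (auto simp: horo_act_def mod_const_def)
  show "mod_const (f \<circ> inv g) \<subseteq> horo_act g (mod_const f)"
  proof
    fix h assume "h \<in> mod_const (f \<circ> inv g)"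
    then obtain c where c: "\<And>x. h x = f (inv g x) + c" by (auto simp: mod_const_def)
    have "h = (h \<circ> g) \<circ> inv g" using that by (auto simp: bij_is_surj surj_f_inv_f)
    moreover have "h \<circ> g \<in> mod_const f"
      using that c by (auto simp: mod_const_def bij_is_inj)
    ultimately show "h \<in> horo_act g (mod_const f)" unfolding horo_act_def by blast
  qed
qed

lemma horo_act_embed: "horo_act g (horo_embed d y) = horo_embed d (g y)"
  if "bij g" and "\<And>x y. d (g x) (g y) = d x y"
proof -
  have "d y \<circ> inv g = d (g y)"
  proof
    fix x
    show "(d y \<circ> inv g) x = d (g y) x"
      using that(2)[of y "inv g x"] bij_is_surj[OF that(1)] by (simp add: surj_f_inv_f)
  qed
  then show ?thesis
    using horo_act_mod_const[OF that(1), of "d y"] by (simp add: horo_embed_def)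
qed


section \<open>The max metric and the diagonal action\<close>

definition max_dist :: "'a::metric_space \<times> 'a \<Rightarrow> 'a \<times> 'a \<Rightarrow> real" where
  "max_dist p q = max (dist (fst p) (fst q)) (dist (snd p) (snd q))"

interpretation max_dist: Metric_space "UNIV :: ('a::metric_space \<times> 'a) set" max_dist
proof
  fix p q r :: "'a \<times> 'a"
  show "max_dist p r \<le> max_dist p q + max_dist q r"
    unfolding max_dist_def
    using dist_triangle[of "fst p" "fst r" "fst q"] dist_triangle[of "snd p" "snd r" "snd q"] by linarith
  show "max_dist p q = 0 \<longleftrightarrow> p = q"
  proof
    assume "max_dist p q = 0"
    then have "dist (fst p) (fst q) \<le> 0" "dist (snd p) (snd q) \<le> 0"
      unfolding max_dist_def by linarith+
    then show "p = q" by (simp add: prod_eq_iff)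
  qed (simp add: max_dist_def)
  show "0 \<le> max_dist p q" by (simp add: max_dist_def le_max_iff_disj)
  show "max_dist p q = max_dist q p" by (simp add: max_dist_def dist_commute)
qed

definition diag_act :: "('a \<Rightarrow> 'a) \<Rightarrow> ('a \<times> 'a \<Rightarrow> real) set \<Rightarrow> ('a \<times> 'a \<Rightarrow> real) set" where
  "diag_act g = horo_act (map_prod g g)"

lemma diag_act_embed:
  assumes "surj g" and "\<And>x y. dist (g x) (g y) = dist x y"
  shows "diag_act g (horo_embed max_dist (x, y)) = horo_embed max_dist (g x, g y)"
proof -
  have "inj g" by (metis assms(2) dist_eq_0_iff injI)
  then have "bij (map_prod g g)"
    using assms(1) by (simp add: bij_def prod.inj_map map_prod_surj)
  then show ?thesis
    unfolding diag_act_def using horo_act_embed[of "map_prod g g" max_dist "(x, y)"] assms(2)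
    by (simp add: max_dist_def)
qed

text \<open>\<open>X \<times> X\<close>, identified with its image in the compactification, and the boundary for the max
  metric.\<close>

abbreviation max_topology :: "('a::metric_space \<times> 'a \<Rightarrow> real) set topology" where
  "max_topology \<equiv> horo_topology max_dist"

abbreviation max_product :: "('a::metric_space \<times> 'a \<Rightarrow> real) set set" where
  "max_product \<equiv> range (horo_embed max_dist)"

abbreviation max_boundary :: "('a::metric_space \<times> 'a \<Rightarrow> real) set set" where
  "max_boundary \<equiv> ideal_boundary max_dist"

end

theory Submission
  imports Defs
begin

text \<open>
  Call \<open>F z = f (z, z)\<close> the restriction to the diagonal of a representative \<open>f\<close> of a point of the
  compactification; for the point \<open>(x, y)\<close> of the product it is \<open>max (d x z) (d y z)\<close>. Everything is
  governed by the values of \<open>F\<close> on one orbit \<open>\<Gamma> b\<close>. The set \<open>\<Omega>\<close> consists of the boundary points whose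
  \<open>F\<close> attains a minimum on \<open>\<Gamma> b\<close>, and together with the product \<open>X \<times> X\<close> it forms the set
  \<open>domain\<close> of all points with this property.

  \<^bold>\<open>Proper discontinuity and cocompactness.\<close> The CAT(-1) inequality makes \<open>X\<close> Gromov hyperbolic, and the
  four-point inequality for \<open>d x\<close> and \<open>d y\<close> passes to their maximum and to limits, hence to every \<open>F\<close>
  (\<open>horofunction_four_point\<close>). It says that \<open>F\<close> is coarsely convex with slope one: once \<open>F\<close> has failed
  to drop along a sufficiently long initial piece of a geodesic, it grows at unit speed from there on. Because
  geodesics between points of \<open>\<Gamma> b\<close> stay near \<open>\<Gamma> b\<close>, an almost minimum among the orbit points of a
  ball of fixed radius is a global almost minimum, and \<open>F\<close> grows linearly away from it with uniform
  constants (\<open>local_minimum_global\<close>). A condition at finitely many orbit points is open, so \<open>domain\<close>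
  is open; almost minima of one \<open>F\<close> are uniformly close to one another, so \<open>\<Gamma>\<close> acts properly
  discontinuously; and the classes whose \<open>F\<close> is minimal at \<open>b\<close> form a closed subset of a
  compact space whose translates cover \<open>domain\<close>.

  \<^bold>\<open>Maximality.\<close> Let \<open>[f]\<close> be a boundary point outside \<open>domain\<close>. Then \<open>F\<close> is unbounded below on
  \<open>\<Gamma> b\<close>. Writing \<open>f\<close> as a limit of \<open>max (d x\<^sub>n) (d y\<^sub>n)\<close> up to constants, this forces those
  of the sequences \<open>x\<^sub>n\<close>, \<open>y\<^sub>n\<close> that contribute to \<open>f\<close> to converge to one and the same boundary point
  of \<open>X\<close>, and in a CAT(-1) space a boundary point has only one horofunction \<open>u\<close> up to constants. So
  \<open>f (x, y) = \<Phi> (u x) (u y)\<close>, where \<open>\<Phi> s t\<close> is, up to a constant, \<open>s\<close>, \<open>t\<close> or \<open>max (s + c) t\<close>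
  (\<open>horofunction_join\<close>). Such a \<open>\<Phi>\<close> commutes with adding a constant to both arguments,
  so a group element that moves \<open>u\<close> only a little, up to constants, moves \<open>[f]\<close> only a little. A
  dynamical argument (\<open>horofunction_fixed_or_recurrent\<close>) shows that either \<open>\<Gamma>\<close> fixes \<open>u\<close> up to
  constants or there are \<open>\<gamma>\<^sub>n\<close> leaving every finite set with \<open>\<gamma>\<^sub>n u \<rightarrow> u\<close> up to constants. The compact set
  \<open>{[f]}\<close>, respectively \<open>{[f]}\<close> together with a tail of the sequence \<open>\<gamma>\<^sub>n [f]\<close>, then meets infinitely
  many of its translates, so no open set containing \<open>[f]\<close> carries a properly discontinuous action.
\<close>

section \<open>Polar coordinates in the hyperbolic plane\<close>

text \<open>This is the point at distance \<open>s\<close> from \<open>\<i>\<close> in direction \<open>\<theta>\<close>: the image of the point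
  \<open>(cosh s, sinh s cos \<theta>, sinh s sin \<theta>)\<close> of the hyperboloid under
  \<open>(T, X, Y) \<mapsto> (Y + \<i>) / (T - X)\<close>.\<close>

definition hyp_polar :: "real \<Rightarrow> real \<Rightarrow> complex" where
  "hyp_polar \<theta> s = Complex (sinh s * sin \<theta> / (cosh s - sinh s * cos \<theta>)) (1 / (cosh s - sinh s * cos \<theta>))"

text \<open>The map \<open>(T, X, Y) \<mapsto> (Y + \<i>) / (T - X)\<close> carries the hyperboloid model to the upper half-plane, so the
  hyperbolic cosine of the distance is the Lorentz form. In polar coordinates this becomes the
  hyperbolic law of cosines.\<close>

lemma hyp_dist_hyperboloid:
  assumes "T^2 = 1 + X^2 + Y^2" "T'^2 = 1 + X'^2 + Y'^2" "0 < T - X" "0 < T' - X'"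
  shows "hyp_dist (Complex (Y / (T - X)) (1 / (T - X))) (Complex (Y' / (T' - X')) (1 / (T' - X')))
    = arcosh (T * T' - X * X' - Y * Y')"
proof -
  define D D' where "D = T - X" and "D' = T' - X'"
  have D: "D > 0" "D' > 0" using assms by (auto simp: D_def D'_def)
  have "(Y / D - Y' / D')^2 + (1 / D - 1 / D')^2 = ((Y * D' - Y' * D)^2 + (D' - D)^2) / (D * D')^2"
    using D by (simp add: field_simps power2_eq_square)
  also have "(Y * D' - Y' * D)^2 + (D' - D)^2 = (Y^2 + 1) * D'^2 + (Y'^2 + 1) * D^2 - 2 * D * D' * (Y * Y' + 1)"
    by (simp add: algebra_simps power2_eq_square)
  \<comment> \<open>On the hyperboloid, \<open>Y\<^sup>2 + 1 = T\<^sup>2 - X\<^sup>2\<close>.\<close>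
  also have "\<dots> = D * (T + X) * D'^2 + D' * (T' + X') * D^2 - 2 * D * D' * (Y * Y' + 1)"
    using assms(1,2) by (simp add: D_def D'_def algebra_simps power2_eq_square)
  also have "\<dots> = D * D' * (2 * (T * T' - X * X' - Y * Y' - 1))"
    by (simp add: D_def D'_def algebra_simps power2_eq_square)
  finally have *: "(Y / D - Y' / D')^2 + (1 / D - 1 / D')^2 = 2 * (T * T' - X * X' - Y * Y' - 1) / (D * D')"
    using D by (simp add: power2_eq_square)
  have "hyp_dist (Complex (Y / D) (1 / D)) (Complex (Y' / D') (1 / D'))
      = arcosh (1 + ((Y / D - Y' / D')^2 + (1 / D - 1 / D')^2) * (D * D') / 2)"
    by (simp add: hyp_dist_def cmod_power2)
  also have "\<dots> = arcosh (T * T' - X * X' - Y * Y')"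
  proof -
    have E: "1 + 2 * E / (D * D') * (D * D') / 2 = 1 + E" for E using D by simp
    show ?thesis unfolding * E by (simp add: algebra_simps)
  qed
  finally show ?thesis by (simp add: D_def D'_def)
qed

lemma hyp_polar_denominator_pos: "0 < cosh s - sinh s * cos \<theta>" for s \<theta> :: real
proof -
  have "\<bar>sinh s * cos \<theta>\<bar> \<le> \<bar>sinh s\<bar>"
    by (simp add: abs_mult mult_left_le)
  also have "\<dots> < cosh s"
    using sinh_less_cosh_real[of "\<bar>s\<bar>"] by (simp add: sinh_real_abs)
  finally show ?thesis by linarith
qed

lemma hyp_dist_polar:
  "hyp_dist (hyp_polar \<theta> s) (hyp_polar \<phi> t) = arcosh (cosh s * cosh t - sinh s * sinh t * cos (\<theta> - \<phi>))"
proof -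
  have sq: "cosh s ^ 2 = 1 + (sinh s * cos \<theta>)^2 + (sinh s * sin \<theta>)^2" for s \<theta> :: real
    using sin_cos_squared_add2[of \<theta>] cosh_square_eq[of s]
    by (simp add: power_mult_distrib flip: distrib_left)
  show ?thesis unfolding hyp_polar_def
    by (subst hyp_dist_hyperboloid[OF sq sq hyp_polar_denominator_pos hyp_polar_denominator_pos])
      (simp add: cos_diff algebra_simps)
qed

lemma hyp_polar_radial: "hyp_dist (hyp_polar \<theta> s) (hyp_polar \<theta> t) = \<bar>s - t\<bar>"
proof -
  have "cosh s * cosh t - sinh s * sinh t * cos (\<theta> - \<theta>) = cosh \<bar>s - t\<bar>"
    by (simp add: cosh_diff)
  then show ?thesis
    unfolding hyp_dist_polar by (metis abs_ge_zero arcosh_cosh_real)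
qed

lemma geodesic_hyp_polar:
  assumes "0 \<le> l"
  shows "geodesic_in hyp_plane hyp_dist (hyp_polar \<theta> 0) (hyp_polar \<theta> l) (hyp_polar \<theta>)"
proof -
  have "hyp_polar \<theta> s \<in> hyp_plane" for s
    using hyp_polar_denominator_pos by (simp add: hyp_plane_def hyp_polar_def)
  then show ?thesis
    using assms by (auto simp: geodesic_in_def hyp_polar_radial)
qed

text \<open>A comparison triangle exists because \<open>cosh c\<close> lies between \<open>cosh (a - b)\<close> and
  \<open>cosh (a + b)\<close>, which are the values at angle \<open>0\<close> and \<open>\<pi>\<close>.\<close>

lemma exists_comparison_angle:
  fixes a b c :: real
  assumes "0 \<le> a" "0 \<le> b" "c \<le> a + b" "\<bar>a - b\<bar> \<le> c"
  obtains \<theta> where "cosh a * cosh b - sinh a * sinh b * cos \<theta> = cosh c"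
proof (cases "sinh a * sinh b = 0")
  case True
  then have "a = 0 \<or> b = 0" by simp
  then have "cosh a * cosh b - sinh a * sinh b * cos 0 = cosh c"
    using assms by (auto simp: abs_if split: if_splits)
  then show ?thesis using that by blast
next
  case False
  then have "0 < a" "0 < b" using assms by (auto simp: less_le)
  then have pos: "0 < sinh a * sinh b" by simp
  have 1: "cosh c \<le> cosh (a + b)" using assms by (subst cosh_real_nonneg_le_iff) auto
  have 2: "cosh (a - b) \<le> cosh c"
    using cosh_real_nonneg_le_iff[of "\<bar>a - b\<bar>" c] assms by simp
  define x where "x = (cosh a * cosh b - cosh c) / (sinh a * sinh b)"
  have "-1 \<le> x" "x \<le> 1"
    using pos 1 2 by (auto simp: x_def cosh_add cosh_diff field_simps)
  then have "cos (arccos x) = x" by simp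
  moreover have "cosh a * cosh b - sinh a * sinh b * x = cosh c"
    using x_def pos nonzero_eq_divide_eq[of "sinh a * sinh b" x "cosh a * cosh b - cosh c"]
    by (simp only: mult.commute)
  ultimately show ?thesis using that by metis
qed

section \<open>Hyperbolicity of CAT(-1) spaces\<close>

lemma CAT_minus1_law_of_cosines:
  fixes p q r :: "'a::metric_space"
  assumes CAT: "CAT_minus1 (UNIV :: 'a set) dist"
    and a: "geodesic_in UNIV dist p q a" and b: "geodesic_in UNIV dist p r b"
    and s: "0 \<le> s" "s \<le> dist p q" and t: "0 \<le> t" "t \<le> dist p r"
    and ang: "cosh (dist p q) * cosh (dist p r) - sinh (dist p q) * sinh (dist p r) * cos \<theta> = cosh (dist q r)"
  shows "cosh (dist (a s) (b t)) \<le> cosh s * cosh t - sinh s * sinh t * cos \<theta>"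
proof -
  define P Q R where "P = hyp_polar \<theta> 0" and "Q = hyp_polar \<theta> (dist p q)" and "R = hyp_polar 0 (dist p r)"
  have P: "P = hyp_polar 0 0" by (simp add: P_def hyp_polar_def)
  have mem: "hyp_polar \<phi> x \<in> hyp_plane" for \<phi> x
    using hyp_polar_denominator_pos by (simp add: hyp_plane_def hyp_polar_def)
  have d1: "hyp_dist P Q = dist p q" unfolding P_def Q_def by (simp add: hyp_polar_radial)
  have d2: "hyp_dist P R = dist p r" unfolding P R_def by (simp add: hyp_polar_radial)
  have d3: "hyp_dist Q R = dist q r"
    unfolding Q_def R_def hyp_dist_polar using ang by (simp add: arcosh_cosh_real)
  have g1: "geodesic_in hyp_plane hyp_dist P Q (hyp_polar \<theta>)"
    unfolding P_def Q_def by (rule geodesic_hyp_polar) simp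
  have g2: "geodesic_in hyp_plane hyp_dist P R (hyp_polar 0)"
    unfolding P R_def by (rule geodesic_hyp_polar) simp
  have "dist (a s) (b t) \<le> hyp_dist (hyp_polar \<theta> s) (hyp_polar 0 t)"
    using CAT d1 d2 d3 g1 g2 a b s t mem unfolding CAT_minus1_def P_def[symmetric] Q_def[symmetric] R_def[symmetric]
    by (metis (no_types, lifting) P_def Q_def R_def UNIV_I atLeastAtMost_iff)
  also have "\<dots> = arcosh (cosh s * cosh t - sinh s * sinh t * cos \<theta>)"
    by (simp add: hyp_dist_polar)
  finally have le: "dist (a s) (b t) \<le> arcosh (cosh s * cosh t - sinh s * sinh t * cos \<theta>)" .
  have "sinh s * sinh t * cos \<theta> \<le> sinh s * sinh t"
    using s t by (simp add: mult_left_le)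
  moreover have "1 \<le> cosh (s - t)" by (rule cosh_real_ge_1)
  ultimately have "1 \<le> cosh s * cosh t - sinh s * sinh t * cos \<theta>"
    by (simp add: cosh_diff)
  moreover have "cosh (dist (a s) (b t)) \<le> cosh (arcosh (cosh s * cosh t - sinh s * sinh t * cos \<theta>))"
    using le by (subst cosh_real_nonneg_le_iff) (auto intro: order_trans[OF zero_le_dist])
  ultimately show ?thesis by (simp add: cosh_arcosh_real)
qed

definition gromov_product :: "'a::metric_space \<Rightarrow> 'a \<Rightarrow> 'a \<Rightarrow> real" where
  "gromov_product p q r = (dist p q + dist p r - dist q r) / 2"

lemma gromov_product_commute: "gromov_product p q r = gromov_product p r q"
  by (simp add: gromov_product_def dist_commute)

lemma gromov_product_bounds: "0 \<le> gromov_product p q r" "gromov_product p q r \<le> dist p q"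
  "gromov_product p q r \<le> dist p r"
  using dist_triangle[of q r p] dist_triangle[of p r q] dist_triangle[of p q r]
  by (auto simp: gromov_product_def dist_commute)

lemma sinh_diff_le: "sinh (a - g) \<le> exp (- g) * sinh a" if "0 \<le> g" for a g :: real
proof -
  have "exp (- a - g) \<le> exp (g - a)" using that by simp
  then show ?thesis
    by (simp add: sinh_field_def exp_diff exp_add exp_minus field_simps)
qed

text \<open>The comparison angle \<open>\<theta>\<close> at \<open>p\<close> satisfies
  \<open>1 - cos \<theta> = 2 sinh (A - g) sinh (B - g) / (sinh A sinh B) \<le> 2 exp (- 2 g)\<close>, where \<open>A\<close> and
  \<open>B\<close> are the lengths of the sides at \<open>p\<close> and \<open>g\<close> is the Gromov product. This one estimate serves
  twice: it gives Gromov hyperbolicity, and it gives convergence of horofunctions, since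
  the distance at a fixed parameter \<open>s\<close> tends to zero as \<open>g\<close> grows.\<close>

lemma CAT_minus1_fellow_travel:
  fixes p q r :: "'a::metric_space"
  assumes CAT: "CAT_minus1 (UNIV :: 'a set) dist"
    and a: "geodesic_in UNIV dist p q a" and b: "geodesic_in UNIV dist p r b"
    and s: "0 \<le> s" "s \<le> dist p q" "s \<le> dist p r"
  shows "sinh (dist (a s) (b s) / 2) \<le> sinh s * exp (- gromov_product p q r)"
proof (cases "s = 0")
  case True
  then have "a s = b s" using a b by (simp add: geodesic_in_def)
  then show ?thesis by (simp add: True)
next
  case False
  define A B where "A = dist p q" and "B = dist p r"
  define g where "g = gromov_product p q r"
  have AB: "0 < A" "0 < B" using False s by (auto simp: A_def B_def)
  have gb: "0 \<le> g" "g \<le> A" "g \<le> B" using gromov_product_bounds by (auto simp: g_def A_def B_def)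
  have c: "dist q r = A + B - 2 * g" by (simp add: g_def gromov_product_def A_def B_def field_simps)
  obtain \<theta> where ang: "cosh A * cosh B - sinh A * sinh B * cos \<theta> = cosh (dist q r)"
    by (rule exists_comparison_angle[of A B "dist q r"]) (use AB gb c in auto)
  have "cosh (dist (a s) (b s)) \<le> cosh s * cosh s - sinh s * sinh s * cos \<theta>"
    using CAT_minus1_law_of_cosines[OF CAT a b s(1,2) s(1,3)] ang by (simp add: A_def B_def)
  then have 1: "cosh (dist (a s) (b s)) \<le> 1 + (sinh s)^2 * (1 - cos \<theta>)"
    using cosh_square_eq[of s] by (simp add: algebra_simps power2_eq_square)
  have "sinh A * sinh B * (1 - cos \<theta>) = cosh (dist q r) - cosh (A - B)"
    using ang by (simp add: cosh_diff algebra_simps)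
  also have "\<dots> = 2 * (sinh (A - g) * sinh (B - g))"
  proof -
    have "cosh (dist q r) = cosh ((A - g) + (B - g))" by (simp add: c algebra_simps)
    moreover have "cosh (A - B) = cosh ((A - g) - (B - g))" by simp
    ultimately show ?thesis by (simp only: cosh_add cosh_diff)
  qed
  also have "\<dots> \<le> 2 * ((exp (- g) * sinh A) * (exp (- g) * sinh B))"
    using gb AB by (intro mult_left_mono mult_mono sinh_diff_le) auto
  also have "\<dots> = sinh A * sinh B * (2 * (exp (- g))^2)" by (simp add: power2_eq_square)
  finally have "1 - cos \<theta> \<le> 2 * (exp (- g))^2"
    using AB by (simp add: mult_le_cancel_left_pos)
  then have "(sinh s)^2 * (1 - cos \<theta>) \<le> (sinh s)^2 * (2 * (exp (- g))^2)"
    by (intro mult_left_mono) auto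
  with 1 have "cosh (dist (a s) (b s)) \<le> 1 + 2 * (sinh s * exp (- g))^2"
    by (simp add: power_mult_distrib)
  moreover have "cosh (dist (a s) (b s)) = 1 + 2 * (sinh (dist (a s) (b s) / 2))^2"
    using cosh_double[of "dist (a s) (b s) / 2"] cosh_square_eq[of "dist (a s) (b s) / 2"] by simp
  ultimately have "(sinh (dist (a s) (b s) / 2))^2 \<le> (sinh s * exp (- g))^2" by simp
  then show ?thesis
    using s(1) by (simp add: g_def power2_le_iff_abs_le)
qed

lemma CAT_minus1_geodesic:
  fixes x y :: "'a::metric_space"
  assumes "CAT_minus1 (UNIV :: 'a set) dist"
  obtains c where "geodesic_in UNIV dist x y c"
  using assms unfolding CAT_minus1_def geodesic_space_def by blast

lemma real_le_sinh: "x \<le> sinh x" if "0 \<le> x" for x :: real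
proof -
  have "sinh 0 - 0 \<le> sinh x - x"
    using that by (intro DERIV_nonneg_imp_nondecreasing[of 0 x "\<lambda>x. sinh x - x"])
      (auto intro!: exI derivative_eq_intros simp: cosh_real_ge_1)
  then show ?thesis by simp
qed

lemma sinh_le_exp_half: "sinh s \<le> exp s / 2" for s :: real
  by (simp add: sinh_field_def)

lemma CAT_minus1_fellow_travel_exp:
  fixes p q r :: "'a::metric_space"
  assumes CAT: "CAT_minus1 (UNIV :: 'a set) dist"
    and a: "geodesic_in UNIV dist p q a" and b: "geodesic_in UNIV dist p r b"
    and s: "0 \<le> s" "s \<le> dist p q" "s \<le> dist p r"
  shows "dist (a s) (b s) \<le> exp (s - gromov_product p q r)"
proof -
  have "dist (a s) (b s) / 2 \<le> sinh (dist (a s) (b s) / 2)"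
    by (rule real_le_sinh) simp
  also have "\<dots> \<le> sinh s * exp (- gromov_product p q r)"
    by (rule CAT_minus1_fellow_travel[OF assms])
  also have "\<dots> \<le> exp s / 2 * exp (- gromov_product p q r)"
    by (intro mult_right_mono sinh_le_exp_half) simp
  finally show ?thesis by (simp add: exp_diff exp_minus field_simps)
qed

lemma geodesic_dist_end:
  assumes "geodesic_in UNIV dist x y c" "0 \<le> s" "s \<le> dist x y"
  shows "dist x (c s) = s" "dist (c s) y = dist x y - s"
proof -
  have "\<forall>s\<in>{0..dist x y}. \<forall>t\<in>{0..dist x y}. dist (c s) (c t) = \<bar>s - t\<bar>" "c 0 = x" "c (dist x y) = y"
    using assms(1) by (auto simp: geodesic_in_def)
  then show "dist x (c s) = s" "dist (c s) y = dist x y - s"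
    using assms(2,3)
    by (metis (no_types, opaque_lifting) abs_minus_commute abs_of_nonneg atLeastAtMost_iff diff_zero dual_order.refl zero_le_dist diff_ge_0_iff_ge)+
qed

text \<open>At the parameter \<open>m\<close> equal to the smaller product, the geodesics to \<open>q\<close>, \<open>w\<close> and \<open>r\<close> are
  consecutively at distance at most \<open>1\<close>, which bounds \<open>dist q r\<close> by a path through them.\<close>

lemma CAT_minus1_gromov_hyperbolic:
  fixes p q r w :: "'a::metric_space"
  assumes CAT: "CAT_minus1 (UNIV :: 'a set) dist"
  shows "min (gromov_product p q w) (gromov_product p w r) - 1 \<le> gromov_product p q r"
proof -
  obtain a b c where a: "geodesic_in UNIV dist p q a" and b: "geodesic_in UNIV dist p r b"
    and c: "geodesic_in UNIV dist p w c" using CAT_minus1_geodesic[OF CAT] by metis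
  define m where "m = min (gromov_product p q w) (gromov_product p w r)"
  have m: "0 \<le> m" "m \<le> dist p q" "m \<le> dist p r" "m \<le> dist p w"
    unfolding m_def using gromov_product_bounds[of p q w] gromov_product_bounds[of p w r] by auto
  have "dist (a m) (c m) \<le> exp (m - gromov_product p q w)"
    by (rule CAT_minus1_fellow_travel_exp[OF CAT a c]) (use m in auto)
  also have "\<dots> \<le> 1" by (simp add: m_def)
  finally have 1: "dist (a m) (c m) \<le> 1" .
  have "dist (c m) (b m) \<le> exp (m - gromov_product p w r)"
    by (rule CAT_minus1_fellow_travel_exp[OF CAT c b]) (use m in auto)
  also have "\<dots> \<le> 1" by (simp add: m_def)
  finally have 2: "dist (c m) (b m) \<le> 1" .
  have "dist q r \<le> dist q (a m) + dist (a m) (c m) + dist (c m) (b m) + dist (b m) r"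
    using dist_triangle[of q r "a m"] dist_triangle[of "a m" r "c m"] dist_triangle[of "c m" r "b m"] by linarith
  also have "\<dots> \<le> (dist p q - m) + 1 + 1 + (dist p r - m)"
    using 1 2 geodesic_dist_end[OF a m(1,2)] geodesic_dist_end[OF b m(1,3)] by (simp add: dist_commute)
  finally show ?thesis unfolding m_def[symmetric] by (simp add: gromov_product_def field_simps)
qed

lemma CAT_minus1_four_point:
  fixes p q r x :: "'a::metric_space"
  assumes "CAT_minus1 (UNIV :: 'a set) dist"
  shows "dist x q + dist p r \<le> max (dist x p + dist q r) (dist x r + dist p q) + 2"
  using CAT_minus1_gromov_hyperbolic[OF assms, of x p q r]
  by (auto simp: gromov_product_def dist_commute min_def max_def field_simps split: if_splits)

text \<open>Going from \<open>x\<close> to \<open>z\<close> through a point of the geodesic from \<open>b\<close> to \<open>x\<close> costs almost nothing when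
  that point is far from \<open>b\<close>: seen from \<open>x\<close>, the points \<open>b\<close> and \<open>z\<close> have Gromov product at least
  \<open>dist x b - R\<close>, so the two geodesics issuing from \<open>x\<close> are at distance at most \<open>exp (R - s)\<close> at the
  parameter \<open>dist x b - s\<close>.\<close>

lemma CAT_minus1_detour:
  fixes x z b :: "'a::metric_space"
  assumes CAT: "CAT_minus1 (UNIV :: 'a set) dist"
    and a: "geodesic_in UNIV dist b x a" and z: "dist b z \<le> R" and s: "R \<le> s" "s \<le> dist b x"
  shows "dist x (a s) + dist (a s) z - dist x z \<le> exp (R - s)"
proof -
  have R: "0 \<le> R" using z zero_le_dist[of b z] by linarith
  define A where "A = dist x b"
  \<comment> \<open>The estimate is applied at the vertex \<open>x\<close>, so the geodesic is reversed.\<close>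
  define a' where "a' = (\<lambda>t. a (A - t))"
  have a': "geodesic_in UNIV dist x b a'"
    using a by (auto simp: geodesic_in_def a'_def A_def dist_commute)
  obtain c where c: "geodesic_in UNIV dist x z c" using CAT_minus1_geodesic[OF CAT] .
  have tri: "A \<le> dist x z + R" using z dist_triangle[of x b z] by (simp add: A_def dist_commute)
  define t where "t = A - s"
  have t: "0 \<le> t" "t \<le> dist x b" "t \<le> dist x z"
    using s R tri by (auto simp: t_def A_def dist_commute)
  have as: "a' t = a s" by (simp add: a'_def t_def)
  have "dist (a s) (c t) \<le> exp (t - gromov_product x b z)"
    using CAT_minus1_fellow_travel_exp[OF CAT a' c t] by (simp add: as)
  also have "\<dots> \<le> exp (R - s)"
    using tri z by (simp add: gromov_product_def t_def A_def field_simps)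
  finally have 1: "dist (a s) (c t) \<le> exp (R - s)" .
  have "dist (a s) z \<le> dist (a s) (c t) + (dist x z - t)"
    using dist_triangle[of "a s" z "c t"] geodesic_dist_end[OF c t(1,3)] by simp
  moreover have "dist x (a s) = t" using geodesic_dist_end(1)[OF a' t(1,2)] by (simp add: as)
  ultimately show ?thesis using 1 by simp
qed

text \<open>The distance functions of two points with large Gromov product are close on balls up to a constant. This
  is where more than Gromov hyperbolicity is needed, which would only bound the difference. Both
  functions are close to that of a point at distance \<open>s\<close> from \<open>b\<close> on the respective geodesic; \<open>s\<close> is chosen
  first, and then \<open>T\<close> so that these two points are close.\<close>

lemma CAT_minus1_busemann_close:
  fixes R e :: real
  assumes CAT: "CAT_minus1 (UNIV :: 'a::metric_space set) dist" and "0 < e"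
  obtains T where "\<And>b x y z :: 'a. T \<le> gromov_product b x y \<Longrightarrow> dist b z \<le> R \<Longrightarrow>
    \<bar>(dist x z - dist x b) - (dist y z - dist y b)\<bar> \<le> e"
proof -
  define s where "s = max 0 R + \<bar>ln (e / 3)\<bar>"
  have s: "R \<le> s" "0 \<le> s" by (auto simp: s_def)
  have es: "exp (R - s) \<le> e / 3"
  proof -
    have "R - s \<le> ln (e / 3)" by (auto simp: s_def)
    then show ?thesis using \<open>0 < e\<close> by (metis exp_le_cancel_iff exp_ln zero_less_divide_iff zero_less_numeral)
  qed
  define T where "T = s + \<bar>ln (e / 3)\<bar>"
  have eT: "exp (s - T) \<le> e / 3"
  proof -
    have "s - T \<le> ln (e / 3)" by (auto simp: T_def)
    then show ?thesis using \<open>0 < e\<close> by (metis exp_le_cancel_iff exp_ln zero_less_divide_iff zero_less_numeral)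
  qed
  have "\<bar>(dist x z - dist x b) - (dist y z - dist y b)\<bar> \<le> e"
    if T: "T \<le> gromov_product b x y" and z: "dist b z \<le> R" for b x y z :: 'a
  proof -
    obtain \<alpha> \<beta> where \<alpha>: "geodesic_in UNIV dist b x \<alpha>" and \<beta>: "geodesic_in UNIV dist b y \<beta>"
      using CAT_minus1_geodesic[OF CAT] by metis
    have sx: "s \<le> dist b x" "s \<le> dist b y"
      using T gromov_product_bounds(2,3)[of b x y] by (auto simp: T_def)
    have 1: "dist x (\<alpha> s) + dist (\<alpha> s) z - dist x z \<le> e / 3"
      using CAT_minus1_detour[OF CAT \<alpha> z s(1) sx(1)] es by linarith
    have 2: "dist y (\<beta> s) + dist (\<beta> s) z - dist y z \<le> e / 3"
      using CAT_minus1_detour[OF CAT \<beta> z s(1) sx(2)] es by linarith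
    have "dist (\<alpha> s) (\<beta> s) \<le> exp (s - gromov_product b x y)"
      by (rule CAT_minus1_fellow_travel_exp[OF CAT \<alpha> \<beta> s(2) sx])
    also have "\<dots> \<le> exp (s - T)" using T by simp
    finally have 3: "dist (\<alpha> s) (\<beta> s) \<le> e / 3" using eT by linarith
    have 4: "dist x (\<alpha> s) = dist x b - s" "dist y (\<beta> s) = dist y b - s"
      using geodesic_dist_end[OF \<alpha> s(2) sx(1)] geodesic_dist_end[OF \<beta> s(2) sx(2)] by (auto simp: dist_commute)
    have 5: "dist x z \<le> dist x (\<alpha> s) + dist (\<alpha> s) z" "dist y z \<le> dist y (\<beta> s) + dist (\<beta> s) z"
      by (rule dist_triangle)+
    have 6: "\<bar>dist (\<alpha> s) z - dist (\<beta> s) z\<bar> \<le> dist (\<alpha> s) (\<beta> s)"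
      using dist_triangle[of "\<alpha> s" z "\<beta> s"] dist_triangle[of "\<beta> s" z "\<alpha> s"]
      by (simp add: dist_commute abs_le_iff)
    show ?thesis using 1 2 3 4 5 6 \<open>0 < e\<close> by linarith
  qed
  then show ?thesis using that by blast
qed

section \<open>The horofunction compactification\<close>

text \<open>Functions modulo constants are determined by their differences, which unlike their values are functions
  of the class.\<close>

definition class_diff :: "('b \<Rightarrow> real) set \<Rightarrow> 'b \<Rightarrow> 'b \<Rightarrow> real" where
  "class_diff A p q = (SOME f. f \<in> A) p - (SOME f. f \<in> A) q"

lemma class_diff_mod_const [simp]: "class_diff (mod_const f) p q = f p - f q"
proof -
  have "f \<in> mod_const f" by (auto simp: mod_const_def intro: exI[of _ 0])
  then have "(SOME g. g \<in> mod_const f) \<in> mod_const f" by (rule someI[where P="\<lambda>g. g \<in> mod_const f"])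
  then obtain c where "(SOME g. g \<in> mod_const f) x = f x + c" for x
    unfolding mod_const_def by blast
  then show ?thesis by (simp add: class_diff_def)
qed

lemma mod_const_eqI:
  assumes "\<And>x. f x = g x + c"
  shows "mod_const f = mod_const g"
proof -
  have "(\<exists>c'. \<forall>x. h x = f x + c') \<longleftrightarrow> (\<exists>c'. \<forall>x. h x = g x + c')" for h
  proof
    assume "\<exists>c'. \<forall>x. h x = f x + c'"
    then obtain c' where "\<forall>x. h x = f x + c'" by blast
    then show "\<exists>c'. \<forall>x. h x = g x + c'" by (intro exI[of _ "c + c'"]) (simp add: assms)
  next
    assume "\<exists>c'. \<forall>x. h x = g x + c'"
    then obtain c' where "\<forall>x. h x = g x + c'" by blast
    then show "\<exists>c'. \<forall>x. h x = f x + c'" by (intro exI[of _ "c' - c"]) (simp add: assms)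
  qed
  then show ?thesis by (simp add: mod_const_def)
qed

lemma metric_openin_iff:
  assumes "Metric_space UNIV d"
  shows "openin (Metric_space.mtopology UNIV d) U \<longleftrightarrow> (\<forall>x\<in>U. \<exists>r>0. \<forall>y. d x y < r \<longrightarrow> y \<in> U)"
  using Metric_space.openin_mtopology[OF assms, of U] Metric_space.in_mball[OF assms]
  by (simp add: subset_eq Ball_def)

lemma continuous_map_nonexpanding:
  assumes "Metric_space UNIV d" and "\<And>x y. d (g x) (g y) \<le> d x y"
  shows "continuous_map (Metric_space.mtopology UNIV d) (Metric_space.mtopology UNIV d) g"
  unfolding continuous_map_def
proof (intro conjI allI impI)
  fix U assume U: "openin (Metric_space.mtopology UNIV d) U"
  have "\<exists>r>0. \<forall>y. d x y < r \<longrightarrow> g y \<in> U" if gx: "g x \<in> U" for x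
  proof -
    obtain r where "r > 0" "\<And>z. d (g x) z < r \<Longrightarrow> z \<in> U"
      using U gx unfolding metric_openin_iff[OF assms(1)] by meson
    then show ?thesis using order.strict_trans1[OF assms(2)] by meson
  qed
  then show "openin (Metric_space.mtopology UNIV d) {x \<in> topspace (Metric_space.mtopology UNIV d). g x \<in> U}"
    by (simp add: metric_openin_iff[OF assms(1)] Metric_space.topspace_mtopology[OF assms(1)])
qed (simp add: Metric_space.topspace_mtopology[OF assms(1)])

definition nonexpanding :: "('b \<Rightarrow> 'b \<Rightarrow> real) \<Rightarrow> ('b \<Rightarrow> real) set" where
  "nonexpanding d = {f. \<forall>p q. f p - f q \<le> d p q}"

lemma nonexpanding_cont_funs:
  assumes "Metric_space UNIV d"
  shows "nonexpanding d \<subseteq> cont_funs d"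
proof
  fix f assume f: "f \<in> nonexpanding d"
  interpret Metric_space UNIV d by (fact assms)
  have "\<exists>r>0. \<forall>y. d x y < r \<longrightarrow> f y \<in> U" if U: "open U" "f x \<in> U" for x U
  proof -
    obtain e where e: "e > 0" "ball (f x) e \<subseteq> U" by (rule openE[OF U])
    have "dist (f x) (f y) \<le> d x y" for y
      using f commute[of x y] unfolding nonexpanding_def mem_Collect_eq
      by (metis dist_real_def abs_le_iff minus_diff_eq)
    then have "f y \<in> U" if "d x y < e" for y
      using that order.strict_trans1 e(2) by (fastforce simp: subset_eq)
    then show ?thesis using e(1) by blast
  qed
  then show "f \<in> cont_funs d"
    by (simp add: cont_funs_def continuous_map_def metric_openin_iff[OF assms])
qed

lemma dist_nonexpanding:
  assumes "Metric_space UNIV d"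
  shows "d y \<in> nonexpanding d"
proof -
  have "d y p - d y q \<le> d p q" for p q
    using Metric_space.triangle[OF assms, of y q p] Metric_space.commute[OF assms, of p q] by simp
  then show ?thesis by (simp add: nonexpanding_def)
qed

lemma range_horo_embed_subset:
  assumes "Metric_space UNIV d"
  shows "range (horo_embed d) \<subseteq> mod_const ` nonexpanding d"
  using dist_nonexpanding[OF assms] by (auto simp: horo_embed_def)

lemma continuous_map_class_diff:
  assumes d: "Metric_space UNIV d"
  shows "continuous_map (cont_mod_const d) euclideanreal (\<lambda>A. class_diff A p q)"
proof (rule continuous_compose_quotient_map[OF quotient_map_mod_const])
  interpret Metric_space UNIV d by (fact d)
  have ev: "continuous_map (cont_topology d) euclideanreal (\<lambda>f. f p)" for p
    unfolding continuous_map_def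
  proof (intro conjI allI impI)
    fix U :: "real set" assume U: "openin euclideanreal U"
    have "\<exists>K e. compactin mtopology K \<and> 0 < e \<and>
        compact_open_nhd d f K e \<subseteq> {f \<in> topspace (cont_topology d). f p \<in> U}"
      if "f \<in> {f \<in> topspace (cont_topology d). f p \<in> U}" for f
    proof -
      have "open U" "f p \<in> U" using that U by auto
      then obtain e where e: "e > 0" "ball (f p) e \<subseteq> U" by (rule openE)
      then show ?thesis
        by (intro exI[of _ "{p}"] exI[of _ e])
          (auto simp: compact_open_nhd_def dist_real_def abs_minus_commute subset_eq)
    qed
    then show "openin (cont_topology d) {f \<in> topspace (cont_topology d). f p \<in> U}"
      unfolding openin_cont_topology by auto
  qed auto
  show "continuous_map (cont_topology d) euclideanreal ((\<lambda>A. class_diff A p q) \<circ> mod_const)"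
    by (simp add: comp_def continuous_map_diff ev)
qed

lemma compactin_finite_net:
  assumes d: "Metric_space UNIV d" and K: "compactin (Metric_space.mtopology UNIV d) K" and "0 < e"
  obtains N where "finite N" "\<And>x. x \<in> K \<Longrightarrow> \<exists>p\<in>N. d p x < e"
proof -
  interpret Metric_space UNIV d by (fact d)
  have "mtotally_bounded K" by (rule compactin_imp_mtotally_bounded[OF K])
  then obtain N where N: "finite N" "K \<subseteq> (\<Union>x\<in>N. mball x e)"
    using \<open>0 < e\<close> unfolding mtotally_bounded_def by blast
  have "\<exists>p\<in>N. d p x < e" if "x \<in> K" for x
  proof -
    have "x \<in> (\<Union>p\<in>N. mball p e)" by (rule subsetD[OF N(2) that])
    then obtain p where "p \<in> N" "x \<in> mball p e" by blast
    then show ?thesis by (intro bexI[of _ p]) (simp_all add: in_mball)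
  qed
  then show ?thesis using N(1) that by blast
qed

text \<open>The functions that vanish at \<open>b\<close> and are nonexpanding form a closed subset of a product of compact
  intervals. On them pointwise convergence is convergence on compact sets, since a finite net controls
  a nonexpanding function on a compact set; so the passage to classes is continuous from the
  product topology, and the image is compact.\<close>

lemma compactin_nonexpanding_classes:
  assumes d: "Metric_space UNIV d"
  shows "compactin (cont_mod_const d) (mod_const ` nonexpanding d)"
proof -
  interpret Metric_space UNIV d by (fact d)
  fix b :: 'a
  let ?X = "product_topology (\<lambda>_. euclideanreal) (UNIV :: 'a set)"
  define B where "B = (\<Pi>\<^sub>E x\<in>UNIV. {- d b x .. d b x})"
  define P where "P = (\<Inter>pq\<in>UNIV. {f \<in> topspace ?X. f (fst pq) - f (snd pq) \<in> {.. d (fst pq) (snd pq)}}) \<inter> B"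
  have "compactin ?X B"
    unfolding B_def by (subst compactin_PiE) auto
  moreover have "closedin ?X (\<Inter>pq\<in>UNIV. {f \<in> topspace ?X. f (fst pq) - f (snd pq) \<in> {.. d (fst pq) (snd pq)}})"
    by (intro closedin_INT closedin_continuous_map_preimage[where Y=euclideanreal] continuous_map_diff
        continuous_map_product_projection) auto
  ultimately have P: "compactin ?X P"
    unfolding P_def by (rule closed_Int_compactin[rotated])
  have PL: "P \<subseteq> nonexpanding d"
    by (auto simp: P_def nonexpanding_def)
  have "continuous_map (subtopology ?X P) (cont_mod_const d) mod_const"
    unfolding continuous_map_def
  proof (intro conjI allI impI)
    show "mod_const \<in> topspace (subtopology ?X P) \<rightarrow> topspace (cont_mod_const d)"
      using PL nonexpanding_cont_funs[OF d] by auto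
    fix W assume W: "openin (cont_mod_const d) W"
    show "openin (subtopology ?X P) {f \<in> topspace (subtopology ?X P). mod_const f \<in> W}"
    proof (subst openin_subopen, intro ballI)
      fix f assume f: "f \<in> {f \<in> topspace (subtopology ?X P). mod_const f \<in> W}"
      then have fP: "f \<in> P" "mod_const f \<in> W" by auto
      then obtain K e where K: "compactin mtopology K" "0 < e"
        "compact_open_nhd d f K e \<subseteq> {f \<in> cont_funs d. mod_const f \<in> W}"
        using W PL nonexpanding_cont_funs[OF d] unfolding openin_cont_mod_const openin_cont_topology by blast
      obtain N where N: "finite N" "\<And>x. x \<in> K \<Longrightarrow> \<exists>p\<in>N. d p x < e / 3"
        using compactin_finite_net[OF d K(1), of "e/3"] K(2) by auto
      define T where "T = (\<Inter>p\<in>N. {g \<in> topspace ?X. g p \<in> ball (f p) (e/3)}) \<inter> topspace ?X"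
      have "openin ?X T"
        unfolding T_def
        by (intro openin_INT N(1) openin_continuous_map_preimage[where Y=euclideanreal]
            continuous_map_product_projection) auto
      moreover have "f \<in> T" using K(2) by (auto simp: T_def)
      moreover have "mod_const g \<in> W" if g: "g \<in> P" "g \<in> T" for g
      proof -
        have "\<bar>g x - f x\<bar> < e" if x: "x \<in> K" for x
        proof -
          obtain p where p: "p \<in> N" "d p x < e / 3" using N(2)[OF x] by blast
          have "f x - f p \<le> d x p" "f p - f x \<le> d p x" "g x - g p \<le> d x p" "g p - g x \<le> d p x"
            using PL fP(1) g(1) by (auto simp: nonexpanding_def)
          moreover have "\<bar>f p - g p\<bar> < e / 3" using g(2) p(1) by (auto simp: T_def dist_real_def)
          ultimately show ?thesis using p(2) commute[of p x] by linarith
        qed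
        then have "g \<in> compact_open_nhd d f K e"
          using g(1) PL nonexpanding_cont_funs[OF d] by (auto simp: compact_open_nhd_def)
        then show ?thesis using K(3) by blast
      qed
      ultimately show "\<exists>T. openin (subtopology ?X P) T \<and> f \<in> T \<and>
          T \<subseteq> {f \<in> topspace (subtopology ?X P). mod_const f \<in> W}"
        using fP(1) by (intro exI[of _ "P \<inter> T"]) (auto simp: openin_subtopology_Int2)
    qed
  qed
  then have "compactin (cont_mod_const d) (mod_const ` P)"
    by (rule image_compactin[rotated]) (simp add: P compactin_subtopology)
  moreover have "mod_const ` P = mod_const ` nonexpanding d"
  proof
    show "mod_const ` nonexpanding d \<subseteq> mod_const ` P"
    proof clarify
      fix f assume f: "f \<in> nonexpanding d"
      define g where "g = (\<lambda>x. f x - f b)"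
      have "- d b x \<le> g x" "g x \<le> d b x" for x
      proof -
        have "f x - f b \<le> d x b" "f b - f x \<le> d b x" using f by (simp_all add: nonexpanding_def)
        then show "- d b x \<le> g x" "g x \<le> d b x" using commute[of b x] by (simp_all add: g_def)
      qed
      then have "g \<in> P"
        using f by (auto simp: P_def B_def g_def nonexpanding_def)
      moreover have "mod_const f = mod_const g"
        by (rule mod_const_eqI[of _ _ "f b"]) (simp add: g_def)
      ultimately show "mod_const f \<in> mod_const ` P" by simp
    qed
  qed (use PL in auto)
  ultimately show ?thesis by simp
qed

lemma horo_compactification_nonexpanding:
  assumes d: "Metric_space UNIV d"
  shows "horo_compactification d \<subseteq> mod_const ` nonexpanding d"
proof -
  let ?C = "\<Inter>pq\<in>UNIV. {A \<in> topspace (cont_mod_const d). class_diff A (fst pq) (snd pq) \<in> {.. d (fst pq) (snd pq)}}"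
  have "closedin (cont_mod_const d) ?C"
    by (intro closedin_INT closedin_continuous_map_preimage[where Y=euclideanreal] continuous_map_class_diff d) auto
  moreover have "?C = mod_const ` nonexpanding d"
    using nonexpanding_cont_funs[OF d] by (auto simp: nonexpanding_def)
  ultimately show ?thesis
    unfolding horo_compactification_def by (metis closure_of_minimal range_horo_embed_subset[OF d])
qed

lemma closedin_horo_compactification: "closedin (cont_mod_const d) (horo_compactification d)"
  by (simp add: horo_compactification_def)

lemma compactin_horo_compactification:
  assumes d: "Metric_space UNIV d"
  shows "compactin (cont_mod_const d) (horo_compactification d)"
  using compactin_nonexpanding_classes[OF d] horo_compactification_nonexpanding[OF d]
    closedin_horo_compactification by (rule closed_compactin)

lemma topspace_horo_topology: "topspace (horo_topology d) = horo_compactification d"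
  using closedin_subset[OF closedin_horo_compactification[of d]] by (auto simp: horo_topology_def)

lemma range_embed_compactification:
  assumes d: "Metric_space UNIV d"
  shows "range (horo_embed d) \<subseteq> horo_compactification d"
  unfolding horo_compactification_def
  by (rule closure_of_subset, unfold topspace_cont_mod_const)
    (rule order_trans[OF range_horo_embed_subset[OF d] image_mono[OF nonexpanding_cont_funs[OF d]]])

lemma horo_act_inverse:
  assumes "bij g"
  shows "horo_act g (horo_act (inv g) A) = A"
proof -
  have "f \<circ> inv (inv g) \<circ> inv g = f" for f :: "_ \<Rightarrow> real"
    by (rule ext) (simp add: inv_inv_eq[OF assms] surj_f_inv_f[OF bij_is_surj[OF assms]])
  then show ?thesis by (simp only: horo_act_def image_image image_ident)
qed

lemma horo_act_range_embed:
  assumes d: "Metric_space UNIV d" and g: "bij g" "\<And>x y. d (g x) (g y) = d x y"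
  shows "horo_act g ` range (horo_embed d) = range (horo_embed d)"
proof -
  have "horo_act g ` range (horo_embed d) = horo_embed d ` range g"
    using horo_act_embed[where g=g and d=d, OF g] by (simp add: image_image)
  then show ?thesis using g(1) by (simp add: bij_is_surj)
qed

lemma continuous_map_horo_act:
  assumes d: "Metric_space UNIV d" and g: "bij g" "\<And>x y. d (g x) (g y) = d x y"
  shows "continuous_map (cont_mod_const d) (cont_mod_const d) (horo_act g)"
proof (rule continuous_compose_quotient_map[OF quotient_map_mod_const])
  interpret Metric_space UNIV d by (fact d)
  have gi: "d (inv g x) (inv g y) = d x y" for x y
    using g by (metis bij_inv_eq_iff)
  have ci: "continuous_map mtopology mtopology (inv g)"
    by (rule continuous_map_nonexpanding[OF d]) (simp add: gi)
  have cf: "f \<circ> inv g \<in> cont_funs d" if "f \<in> cont_funs d" for f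
    using that ci unfolding cont_funs_def by (auto intro: continuous_map_compose)
  have "continuous_map (cont_topology d) (cont_topology d) (\<lambda>f. f \<circ> inv g)"
    unfolding continuous_map_def
  proof (intro conjI allI impI)
    fix U assume U: "openin (cont_topology d) U"
    have "\<exists>K e. compactin mtopology K \<and> 0 < e \<and>
        compact_open_nhd d f K e \<subseteq> {f \<in> topspace (cont_topology d). f \<circ> inv g \<in> U}"
      if f: "f \<in> {f \<in> topspace (cont_topology d). f \<circ> inv g \<in> U}" for f
    proof -
      obtain K e where K: "compactin mtopology K" "0 < e" "compact_open_nhd d (f \<circ> inv g) K e \<subseteq> U"
        using f U unfolding openin_cont_topology by blast
      have "h \<circ> inv g \<in> compact_open_nhd d (f \<circ> inv g) K e" if "h \<in> compact_open_nhd d f (inv g ` K) e" for h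
        using that cf by (auto simp: compact_open_nhd_def)
      then have "compact_open_nhd d f (inv g ` K) e \<subseteq> {f \<in> topspace (cont_topology d). f \<circ> inv g \<in> U}"
        using K(3) by (auto simp: compact_open_nhd_def)
      then show ?thesis using image_compactin[OF K(1) ci] K(2) by blast
    qed
    then show "openin (cont_topology d) {f \<in> topspace (cont_topology d). f \<circ> inv g \<in> U}"
      unfolding openin_cont_topology by auto
  qed (use cf in auto)
  then have "continuous_map (cont_topology d) (cont_mod_const d) (mod_const \<circ> (\<lambda>f. f \<circ> inv g))"
    by (rule continuous_map_compose[OF _ quotient_imp_continuous_map[OF quotient_map_mod_const]])
  moreover have "horo_act g \<circ> mod_const = mod_const \<circ> (\<lambda>f. f \<circ> inv g)"
    by (auto simp: horo_act_mod_const[OF g(1)])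
  ultimately show "continuous_map (cont_topology d) (cont_mod_const d) (horo_act g \<circ> mod_const)" by simp
qed

lemma horo_act_compactification:
  assumes d: "Metric_space UNIV d" and g: "bij g" "\<And>x y. d (g x) (g y) = d x y"
  shows "horo_act g ` horo_compactification d = horo_compactification d"
proof -
  have sub: "horo_act g ` horo_compactification d \<subseteq> horo_compactification d"
    if g: "bij g" "\<And>x y. d (g x) (g y) = d x y" for g
    using continuous_map_image_closure_subset[OF continuous_map_horo_act[OF d g], of "range (horo_embed d)"]
    horo_act_range_embed[OF d g]
    by (simp add: horo_compactification_def)
  have gi: "d (inv g x) (inv g y) = d x y" for x y
    using g by (metis bij_inv_eq_iff)
  have "horo_compactification d = horo_act g ` horo_act (inv g) ` horo_compactification d"
    by (simp add: image_image horo_act_inverse[OF g(1)])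
  also have "\<dots> \<subseteq> horo_act g ` horo_compactification d"
    by (intro image_mono sub gi bij_imp_bij_inv g(1))
  finally show ?thesis using sub[OF g] by blast
qed

text \<open>The additive constants \<open>c\<close> may depend on the compact set as well as on the index.\<close>

lemma limitin_mod_const:
  assumes f: "\<And>n. f n \<in> cont_funs d" and g: "g \<in> cont_funs d"
    and lim: "\<And>K e. compactin (Metric_space.mtopology UNIV d) K \<Longrightarrow> 0 < e \<Longrightarrow>
      eventually (\<lambda>n. \<exists>c. \<forall>x\<in>K. \<bar>f n x - g x - c\<bar> < e) F"
  shows "limitin (cont_mod_const d) (\<lambda>n. mod_const (f n)) (mod_const g) F"
  unfolding limitin_def
proof (intro conjI allI impI)
  show "mod_const g \<in> topspace (cont_mod_const d)" using g by simp
  fix W assume W: "openin (cont_mod_const d) W \<and> mod_const g \<in> W"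
  then obtain K e where K: "compactin (Metric_space.mtopology UNIV d) K" "0 < e"
        "compact_open_nhd d g K e \<subseteq> {f \<in> cont_funs d. mod_const f \<in> W}"
    using g unfolding openin_cont_mod_const openin_cont_topology by blast
  show "eventually (\<lambda>n. mod_const (f n) \<in> W) F"
    using lim[OF K(1,2)]
  proof (rule eventually_mono)
    fix n assume "\<exists>c. \<forall>x\<in>K. \<bar>f n x - g x - c\<bar> < e"
    then obtain c where c: "\<And>x. x \<in> K \<Longrightarrow> \<bar>f n x - g x - c\<bar> < e" by blast
    have "(\<lambda>x. f n x - c) \<in> compact_open_nhd d g K e"
      using f[of n] c by (auto simp: compact_open_nhd_def cont_funs_def algebra_simps intro: continuous_map_diff)
    moreover have "mod_const (\<lambda>x. f n x - c) = mod_const (f n)"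
      by (rule mod_const_eqI[of _ _ "-c"]) simp
    ultimately show "mod_const (f n) \<in> W" using K(3) by auto
  qed
qed

section \<open>Horofunctions of the max metric\<close>

lemma metric_max_dist: "Metric_space UNIV max_dist"
  by (rule max_dist.Metric_space_axioms)

lemma abs_max_dist_diff_le: "\<bar>max_dist w p - max_dist w q\<bar> \<le> max_dist p q"
  using max_dist.triangle[of w p q] max_dist.triangle[of w q p] max_dist.commute[of p q] by (simp add: abs_le_iff)

lemma horo_class_nonexpanding:
  assumes "Metric_space UNIV d" "mod_const f \<in> horo_compactification d"
  shows "f p - f q \<le> d p q"
proof -
  obtain h where "mod_const f = mod_const h" "h \<in> nonexpanding d"
    using horo_compactification_nonexpanding[OF assms(1)] assms(2) by blast
  then show ?thesis
    by (metis (mono_tags, lifting) class_diff_mod_const mem_Collect_eq nonexpanding_def)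
qed

text \<open>A sequence of points of the product converges to \<open>f\<close> because finitely many values, taken at a \<open>1 / (n + 1)\<close>-net of a large ball, control a nonexpanding function on
  the ball, and approximating these values is an open condition.\<close>

lemma horo_sequence:
  fixes f :: "'a::heine_borel \<times> 'a \<Rightarrow> real"
  assumes f: "mod_const f \<in> horo_compactification max_dist"
  obtains X Y :: "nat \<Rightarrow> 'a" where
    "\<And>p q. (\<lambda>n. max_dist (X n, Y n) p - max_dist (X n, Y n) q) \<longlonglongrightarrow> f p - f q"
proof -
  fix b :: 'a
  let ?o = "(b, b)"
  have lip: "f p - f q \<le> max_dist p q" for p q
    by (rule horo_class_nonexpanding[OF metric_max_dist f])
  have approx: "\<exists>w. \<forall>p. dist b (fst p) \<le> real n \<longrightarrow> dist b (snd p) \<le> real n \<longrightarrow>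
      \<bar>max_dist w p - max_dist w ?o - (f p - f ?o)\<bar> \<le> 3 / real (Suc n)" for n :: nat
  proof -
    let ?e = "1 / real (Suc n)"
    have e: "?e > 0" by simp
    have "\<forall>e>0. \<exists>k. finite k \<and> cball b (real n) \<subseteq> (\<Union>x\<in>k. ball x e)"
      using compact_cball[of b "real n"] unfolding compact_eq_totally_bounded by (rule conjunct2)
    then have "\<exists>k. finite k \<and> cball b (real n) \<subseteq> (\<Union>x\<in>k. ball x ?e)"
      using e by (elim allE impE)
    then obtain N where N: "finite N" "cball b (real n) \<subseteq> (\<Union>x\<in>N. ball x ?e)"
      by (elim exE conjE)
    define T where "T = (\<Inter>p\<in>N \<times> N. {A \<in> topspace (cont_mod_const max_dist).
        class_diff A p ?o \<in> ball (f p - f ?o) ?e}) \<inter> topspace (cont_mod_const max_dist)"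
    have T: "openin (cont_mod_const max_dist) T"
      unfolding T_def by (intro openin_INT finite_cartesian_product N(1) openin_continuous_map_preimage[where Y=euclideanreal]
          continuous_map_class_diff metric_max_dist) auto
    have fT: "mod_const f \<in> T"
      using nonexpanding_cont_funs[OF metric_max_dist] lip e by (auto simp: nonexpanding_def T_def)
    have "\<exists>B. B \<in> max_product \<and> B \<in> T"
      using f[unfolded horo_compactification_def in_closure_of, THEN conjunct2, rule_format, OF conjI[OF fT T]] .
    then obtain w where "horo_embed max_dist w \<in> T" by blast
    then have w: "\<bar>max_dist w p - max_dist w ?o - (f p - f ?o)\<bar> < ?e" if "p \<in> N \<times> N" for p
      using that by (auto simp: T_def horo_embed_def dist_real_def abs_minus_commute)
    have "\<bar>max_dist w p - max_dist w ?o - (f p - f ?o)\<bar> \<le> 3 / real (Suc n)"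
      if p: "dist b (fst p) \<le> real n" "dist b (snd p) \<le> real n" for p
    proof -
      have "fst p \<in> (\<Union>x\<in>N. ball x ?e)" "snd p \<in> (\<Union>x\<in>N. ball x ?e)"
        by (rule subsetD[OF N(2)], simp add: p)+
      then obtain x y where xy: "x \<in> N" "dist x (fst p) < ?e" "y \<in> N" "dist y (snd p) < ?e"
        by (elim UN_E) (simp only: mem_ball)
      have pq: "max_dist p (x, y) < ?e" using xy by (simp add: max_dist_def dist_commute)
      \<comment> \<open>Replacing \<open>p\<close> by the net point \<open>(x, y)\<close> costs one error for each of the two functions.\<close>
      have "\<bar>max_dist w p - max_dist w (x, y)\<bar> \<le> max_dist p (x, y)" by (rule abs_max_dist_diff_le)
      moreover have "f p - f (x, y) \<le> max_dist p (x, y)" "f (x, y) - f p \<le> max_dist p (x, y)"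
        using lip[of p "(x, y)"] lip[of "(x, y)" p] max_dist.commute[of p "(x, y)"] by auto
      moreover have "3 / real (Suc n) = 3 * ?e" by simp
      ultimately show ?thesis using w[of "(x, y)"] xy pq by auto
    qed
    then show ?thesis by blast
  qed
  then obtain W where W: "\<And>n p. dist b (fst p) \<le> real n \<Longrightarrow> dist b (snd p) \<le> real n \<Longrightarrow>
      \<bar>max_dist (W n) p - max_dist (W n) ?o - (f p - f ?o)\<bar> \<le> 3 / real (Suc n)" by metis
  have null: "(\<lambda>n. max_dist (W n) p - max_dist (W n) ?o - (f p - f ?o)) \<longlonglongrightarrow> 0" for p
  proof (rule Lim_null_comparison)
    show "(\<lambda>n. 3 / real (Suc n)) \<longlonglongrightarrow> 0"
      using tendsto_mult_right_zero[OF LIMSEQ_inverse_real_of_nat, of 3] by (simp add: divide_inverse)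
    obtain m where m: "max (dist b (fst p)) (dist b (snd p)) \<le> real m" using real_arch_simple by blast
    show "\<forall>\<^sub>F n in sequentially. norm (max_dist (W n) p - max_dist (W n) ?o - (f p - f ?o)) \<le> 3 / real (Suc n)"
      using eventually_ge_at_top[of m]
    proof eventually_elim
      case (elim n)
      then have "real m \<le> real n" by simp
      then show ?case using W[of p n] m by simp
    qed
  qed
  have "(\<lambda>n. max_dist (W n) p - max_dist (W n) q) \<longlonglongrightarrow> f p - f q" for p q
    using tendsto_add[OF tendsto_diff[OF null[of p] null[of q]] tendsto_const[of "f p - f q"]]
    by (simp add: algebra_simps)
  then show ?thesis using that[of "fst \<circ> W" "snd \<circ> W"] by simp
qed

text \<open>The four-point inequality holds for \<open>dist x\<close> and for \<open>dist y\<close>. For their maximum it is enough to use the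
  inequality of the one that realises the maximum at \<open>q\<close>, because the other terms only grow. Finally it
  is a closed condition on differences of values.\<close>

lemma horofunction_four_point:
  fixes f :: "'a::heine_borel \<times> 'a \<Rightarrow> real"
  assumes CAT: "CAT_minus1 (UNIV :: 'a set) dist" and f: "mod_const f \<in> horo_compactification max_dist"
  shows "f (q, q) + dist p r \<le> max (f (p, p) + dist q r) (f (r, r) + dist p q) + 2"
proof -
  obtain X Y where XY: "\<And>p q. (\<lambda>n. max_dist (X n, Y n) p - max_dist (X n, Y n) q) \<longlonglongrightarrow> f p - f q"
    using horo_sequence[OF f] by blast
  let ?M = "\<lambda>n z. max_dist (X n, Y n) (z, z)"
  have "dist p r \<le> max ((f (p, p) - f (q, q)) + dist q r) ((f (r, r) - f (q, q)) + dist p q) + 2"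
  proof (rule tendsto_lowerbound)
    show "(\<lambda>n. max ((?M n p - ?M n q) + dist q r) ((?M n r - ?M n q) + dist p q) + 2) \<longlonglongrightarrow>
        max ((f (p, p) - f (q, q)) + dist q r) ((f (r, r) - f (q, q)) + dist p q) + 2"
      by (intro tendsto_add tendsto_max XY tendsto_const)
    have "dist p r \<le> max ((?M n p - ?M n q) + dist q r) ((?M n r - ?M n q) + dist p q) + 2" for n
      using CAT_minus1_four_point[OF CAT, of "X n" q p r] CAT_minus1_four_point[OF CAT, of "Y n" q p r]
      unfolding max_dist_def fst_conv snd_conv by argo
    then show "\<forall>\<^sub>F n in sequentially. dist p r \<le> max ((?M n p - ?M n q) + dist q r) ((?M n r - ?M n q) + dist p q) + 2"
      by simp
  qed simp
  then show ?thesis by argo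
qed

section \<open>The domain of discontinuity\<close>

locale quasi_convex_action =
  fixes \<Gamma> :: "('a::heine_borel \<Rightarrow> 'a) set" and b :: 'a
  assumes CAT: "CAT_minus1 (UNIV :: 'a set) dist"
    and qc: "quasi_convex_group \<Gamma>"
begin

lemma iso: "g \<in> \<Gamma> \<Longrightarrow> dist (g x) (g y) = dist x y"
  and surj: "g \<in> \<Gamma> \<Longrightarrow> surj g"
  and id_mem: "id \<in> \<Gamma>"
  and comp_mem: "g \<in> \<Gamma> \<Longrightarrow> h \<in> \<Gamma> \<Longrightarrow> g \<circ> h \<in> \<Gamma>"
  and inv_mem: "g \<in> \<Gamma> \<Longrightarrow> inv g \<in> \<Gamma>"
  using qc unfolding quasi_convex_group_def isometry_group_def by blast+

lemma bij: "bij g" if "g \<in> \<Gamma>"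
proof -
  have "inj g" by (rule injI) (metis iso[OF that] dist_eq_0_iff)
  then show ?thesis using surj[OF that] by (simp add: bij_def)
qed

lemma inv_apply [simp]: "g \<in> \<Gamma> \<Longrightarrow> inv g (g x) = x" "g \<in> \<Gamma> \<Longrightarrow> g (inv g x) = x"
  using bij by (auto simp: bij_is_inj bij_is_surj surj_f_inv_f)

lemma map_prod_bij: "bij (map_prod g g)" if "g \<in> \<Gamma>"
  using bij[OF that] by (simp add: bij_def prod.inj_map map_prod_surj)

lemma map_prod_iso: "max_dist (map_prod g g p) (map_prod g g q) = max_dist p q" if "g \<in> \<Gamma>"
  by (simp add: max_dist_def iso[OF that])

lemma inv_map_prod: "inv (map_prod g g) p = (inv g (fst p), inv g (snd p))" if "g \<in> \<Gamma>"
  using that by (intro inv_f_eq[OF bij_is_inj[OF map_prod_bij]]) (auto simp: prod_eq_iff)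

lemma diag_act_mod_const: "diag_act g (mod_const f) = mod_const (\<lambda>p. f (inv g (fst p), inv g (snd p)))" if "g \<in> \<Gamma>"
proof -
  have "f \<circ> inv (map_prod g g) = (\<lambda>p. f (inv g (fst p), inv g (snd p)))"
    by (rule ext) (simp add: inv_map_prod[OF that])
  then show ?thesis unfolding diag_act_def horo_act_mod_const[OF map_prod_bij[OF that]] by simp
qed

lemma diag_act_compactification:
  "g \<in> \<Gamma> \<Longrightarrow> diag_act g ` horo_compactification max_dist = horo_compactification max_dist"
  unfolding diag_act_def
  by (rule horo_act_compactification[where d = max_dist]) (simp_all add: metric_max_dist map_prod_bij map_prod_iso)

lemma diag_act_max_product: "g \<in> \<Gamma> \<Longrightarrow> diag_act g ` max_product = max_product"
  unfolding diag_act_def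
  by (rule horo_act_range_embed[where d = max_dist]) (simp_all add: metric_max_dist map_prod_bij map_prod_iso)

lemma diag_act_inv:
  assumes g: "g \<in> \<Gamma>" and A: "A \<in> range mod_const"
  shows "diag_act g (diag_act (inv g) A) = A" "diag_act (inv g) (diag_act g A) = A"
proof -
  have "inv (inv g) = g" by (rule inv_inv_eq[OF bij[OF g]])
  with A g inv_mem[OF g] show "diag_act g (diag_act (inv g) A) = A" "diag_act (inv g) (diag_act g A) = A"
    by (auto simp: diag_act_mod_const)
qed

lemma compactification_range: "horo_compactification max_dist \<subseteq> range mod_const"
  using horo_compactification_nonexpanding[OF metric_max_dist] by auto

lemma diag_act_boundary: "diag_act g A \<in> max_boundary" if g: "g \<in> \<Gamma>" and A: "A \<in> max_boundary"
proof -
  have A': "A \<in> horo_compactification max_dist" "A \<notin> max_product" using A by (auto simp: ideal_boundary_def)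
  have Ar: "A \<in> range mod_const" using A'(1) compactification_range by (rule subsetD[rotated])
  have "diag_act (inv g) (diag_act g A) = A" by (rule diag_act_inv(2)[OF g Ar])
  then have "diag_act g A \<notin> max_product"
    using A'(2) diag_act_max_product[OF inv_mem[OF g]] by (metis imageI)
  then show ?thesis using diag_act_compactification[OF g] A' by (auto simp: ideal_boundary_def)
qed

text \<open>The ball below is chosen so as to contain both \<open>x\<close> and every \<open>g x\<close> with \<open>dist (g x) y \<le> R\<close>.\<close>

lemma finite_near: "finite {g \<in> \<Gamma>. dist (g x) y \<le> R}"
proof -
  let ?K = "cball y (max R (dist x y))"
  have "properly_discontinuous euclidean \<Gamma> (\<lambda>g. g)" using qc by (simp add: quasi_convex_group_def)
  then have "finite {g \<in> \<Gamma>. g ` ?K \<inter> ?K \<noteq> {}}"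
    unfolding properly_discontinuous_def by (elim allE[of _ ?K] impE) (simp_all only: compactin_euclidean_iff compact_cball)
  then show ?thesis
    by (rule rev_finite_subset) (auto simp: dist_commute disjoint_iff intro!: bexI[of _ x])
qed

text \<open>This is \<open>F (g b) - F (h b)\<close> for the restriction \<open>F\<close> to the diagonal of any representative
  of \<open>A\<close>.\<close>

definition orbit_diff :: "('a \<times> 'a \<Rightarrow> real) set \<Rightarrow> ('a \<Rightarrow> 'a) \<Rightarrow> ('a \<Rightarrow> 'a) \<Rightarrow> real" where
  "orbit_diff A g h = class_diff A (g b, g b) (h b, h b)"

lemma orbit_diff_chain:
  assumes "A \<in> range mod_const"
  shows "orbit_diff A g h + orbit_diff A h k = orbit_diff A g k"
  using assms by (auto simp: orbit_diff_def)

lemma orbit_diff_act: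
  assumes "A \<in> range mod_const" "k \<in> \<Gamma>"
  shows "orbit_diff (diag_act k A) (k \<circ> g) (k \<circ> h) = orbit_diff A g h"
  using assms by (auto simp: orbit_diff_def diag_act_mod_const)

text \<open>Let \<open>c\<close> be the geodesic from \<open>g b\<close> to \<open>h b\<close>. By quasi-convexity \<open>c S\<close> is within \<open>\<epsilon>\<close> of an orbit point, so the
  local condition gives \<open>F (c S) \<ge> F (g b) - 1 - \<epsilon>\<close>. As \<open>S > 3 + \<epsilon>\<close>, the four-point inequality for
  \<open>g b\<close>, \<open>c S\<close>, \<open>h b\<close> excludes its first alternative, and the second one says that \<open>F\<close> grows at
  unit speed beyond \<open>c S\<close>.\<close>

lemma local_minimum_global:
  obtains R C where
    "\<And>A g h. A \<in> horo_compactification max_dist \<Longrightarrow> g \<in> \<Gamma> \<Longrightarrow> h \<in> \<Gamma> \<Longrightarrow>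
      (\<And>k. k \<in> \<Gamma> \<Longrightarrow> dist (k b) (g b) \<le> R \<Longrightarrow> orbit_diff A g k \<le> 1) \<Longrightarrow>
      orbit_diff A g h \<le> C - dist (g b) (h b)"
proof -
  obtain \<epsilon> where \<epsilon>: "\<epsilon> \<ge> 0" "\<And>g h c s. g \<in> \<Gamma> \<Longrightarrow> h \<in> \<Gamma> \<Longrightarrow> geodesic_in UNIV dist (g b) (h b) c \<Longrightarrow>
      0 \<le> s \<Longrightarrow> s \<le> dist (g b) (h b) \<Longrightarrow> \<exists>k\<in>\<Gamma>. dist (k b) (c s) \<le> \<epsilon>"
  proof -
    have "quasi_convex ((\<lambda>g. g b) ` \<Gamma>)" using qc by (simp add: quasi_convex_group_def)
    then obtain \<epsilon> where "\<epsilon> \<ge> 0" and e: "\<forall>x\<in>(\<lambda>g. g b) ` \<Gamma>. \<forall>y\<in>(\<lambda>g. g b) ` \<Gamma>. \<forall>c.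
        geodesic_in UNIV dist x y c \<longrightarrow> c ` {0..dist x y} \<subseteq> (\<Union>s\<in>(\<lambda>g. g b) ` \<Gamma>. cball s \<epsilon>)"
      unfolding quasi_convex_def by (elim exE conjE)
    have "\<exists>k\<in>\<Gamma>. dist (k b) (c s) \<le> \<epsilon>"
      if "g \<in> \<Gamma>" "h \<in> \<Gamma>" "geodesic_in UNIV dist (g b) (h b) c" "0 \<le> s" "s \<le> dist (g b) (h b)" for g h c s
    proof -
      have "c s \<in> (\<Union>s\<in>(\<lambda>g. g b) ` \<Gamma>. cball s \<epsilon>)"
        using e[rule_format, OF imageI[OF that(1)] imageI[OF that(2)] that(3)] that(4,5)
        by (meson atLeastAtMost_iff imageI subsetD)
      then show ?thesis by auto
    qed
    then show ?thesis by (rule that[OF \<open>\<epsilon> \<ge> 0\<close>])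
  qed
  define S where "S = \<epsilon> + 4"
  have "orbit_diff A g h \<le> 2 * S - dist (g b) (h b)"
    if A: "A \<in> horo_compactification max_dist" and g: "g \<in> \<Gamma>" and h: "h \<in> \<Gamma>"
      and loc: "\<And>k. k \<in> \<Gamma> \<Longrightarrow> dist (k b) (g b) \<le> S + \<epsilon> \<Longrightarrow> orbit_diff A g k \<le> 1" for A g h
  proof -
    obtain f where f: "A = mod_const f" using A compactification_range by auto
    define F where "F = (\<lambda>z. f (z, z))"
    have lip: "F x - F y \<le> dist x y" for x y
      using horo_class_nonexpanding[OF metric_max_dist A[unfolded f], of "(x, x)" "(y, y)"]
      by (simp add: F_def max_dist_def)
    have four: "F q + dist p r \<le> max (F p + dist q r) (F r + dist p q) + 2" for p q r
      using horofunction_four_point[OF CAT A[unfolded f]] by (simp add: F_def)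
    have od: "orbit_diff A k l = F (k b) - F (l b)" for k l by (simp add: orbit_diff_def f F_def)
    show ?thesis
    proof (cases "dist (g b) (h b) \<le> S")
      case True
      then show ?thesis using lip[of "g b" "h b"] by (simp add: od)
    next
      case False
      obtain c where c: "geodesic_in UNIV dist (g b) (h b) c" using CAT_minus1_geodesic[OF CAT] .
      have S: "0 \<le> S" "S \<le> dist (g b) (h b)" using False \<epsilon>(1) by (auto simp: S_def)
      note cS = geodesic_dist_end[OF c S]
      obtain k where k: "k \<in> \<Gamma>" "dist (k b) (c S) \<le> \<epsilon>" using \<epsilon>(2)[OF g h c S] by blast
      have "dist (k b) (g b) \<le> S + \<epsilon>"
        using k(2) cS(1) dist_triangle[of "k b" "g b" "c S"] by (simp add: dist_commute)
      then have "F (g b) - 1 \<le> F (k b)" using loc[OF k(1)] by (simp add: od)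
      moreover have "F (k b) - \<epsilon> \<le> F (c S)" using lip[of "k b" "c S"] k(2) by simp
      ultimately have "F (g b) - 1 - \<epsilon> \<le> F (c S)" by simp
      with four[of "c S" "g b" "h b"] cS show ?thesis
        by (simp add: od S_def max_def split: if_splits)
    qed
  qed
  then show ?thesis using that by blast
qed

text \<open>This is \<open>X \<times> X\<close> together with \<open>\<Omega>\<close>; by the growth of \<open>F\<close> away from an almost minimum, it is the set of
  classes whose \<open>F\<close> is proper and bounded below on the orbit.\<close>

definition domain :: "('a \<times> 'a \<Rightarrow> real) set set" where
  "domain = {A \<in> horo_compactification max_dist. \<exists>g\<in>\<Gamma>. \<forall>h\<in>\<Gamma>. orbit_diff A g h \<le> 0}"

text \<open>Linear growth away from \<open>g b\<close> leaves only finitely many orbit points at which \<open>F\<close> could be smaller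
  than at \<open>g b\<close>.\<close>

lemma domainI:
  assumes A: "A \<in> horo_compactification max_dist" and g: "g \<in> \<Gamma>"
    and le: "\<And>h. h \<in> \<Gamma> \<Longrightarrow> orbit_diff A g h \<le> C - dist (g b) (h b)"
  shows "A \<in> domain"
proof -
  have Ar: "A \<in> range mod_const" using A compactification_range by blast
  let ?G = "{h \<in> \<Gamma>. dist (h b) (g b) \<le> max 0 C}"
  have "finite ?G" by (rule finite_near)
  moreover have gG: "g \<in> ?G" using g by simp
  ultimately obtain k where k: "k \<in> ?G" "\<And>h. h \<in> ?G \<Longrightarrow> orbit_diff A k g \<le> orbit_diff A h g"
    using arg_min_if_finite(1)[of ?G "\<lambda>h. orbit_diff A h g"] arg_min_least[of ?G _ "\<lambda>h. orbit_diff A h g"]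
    by (metis (no_types, lifting) empty_iff)
  have "orbit_diff A k h \<le> 0" if h: "h \<in> \<Gamma>" for h
  proof (cases "h \<in> ?G")
    case True
    then show ?thesis using k(2)[of h] orbit_diff_chain[OF Ar, of k h g] by simp
  next
    case False
    then have "orbit_diff A g h \<le> 0" using le[OF h] h by (simp add: dist_commute)
    moreover have "orbit_diff A k g \<le> 0"
      using k(2)[OF gG] orbit_diff_chain[OF Ar, of g g g] by simp
    ultimately show ?thesis using orbit_diff_chain[OF Ar, of k g h] by simp
  qed
  then show ?thesis using A k(1) by (auto simp: domain_def)
qed

lemma max_product_subset_domain: "max_product \<subseteq> domain"
proof
  fix A :: "('a \<times> 'a \<Rightarrow> real) set" assume "A \<in> max_product"
  then obtain x y where A: "A = mod_const (max_dist (x, y))" by (auto simp: horo_embed_def)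
  have "orbit_diff A id h \<le> 2 * max (dist x b) (dist y b) - dist (id b) (h b)" for h
    using dist_triangle[of b "h b" x]
    by (auto simp: A orbit_diff_def max_dist_def dist_commute max_def)
  moreover have "A \<in> horo_compactification max_dist"
    using range_embed_compactification[OF metric_max_dist] \<open>A \<in> max_product\<close> by blast
  ultimately show "A \<in> domain" using id_mem by (intro domainI)
qed

lemma diag_act_domain: "diag_act k ` domain = domain" if "k \<in> \<Gamma>"
proof -
  have sub: "diag_act k A \<in> domain" if k: "k \<in> \<Gamma>" and A: "A \<in> domain" for k A
  proof -
    obtain g where Ac: "A \<in> horo_compactification max_dist" and g: "g \<in> \<Gamma>" "\<And>h. h \<in> \<Gamma> \<Longrightarrow> orbit_diff A g h \<le> 0"
      using A by (auto simp: domain_def)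
    then have Ar: "A \<in> range mod_const" using compactification_range by blast
    have "orbit_diff (diag_act k A) (k \<circ> g) h \<le> 0" if h: "h \<in> \<Gamma>" for h
    proof -
      have "h = k \<circ> (inv k \<circ> h)" using k by (simp add: fun_eq_iff)
      then show ?thesis
        using orbit_diff_act[OF Ar k, of g "inv k \<circ> h"] g(2)[OF comp_mem[OF inv_mem[OF k] h]] by simp
    qed
    moreover have "diag_act k A \<in> horo_compactification max_dist"
      using Ac diag_act_compactification[OF k] by blast
    ultimately show ?thesis using comp_mem[OF k g(1)] by (auto simp: domain_def)
  qed
  have "A \<in> diag_act k ` domain" if A: "A \<in> domain" for A
  proof -
    have "A \<in> range mod_const" using A compactification_range by (auto simp: domain_def)
    then have "A = diag_act k (diag_act (inv k) A)" using diag_act_inv(1)[OF \<open>k \<in> \<Gamma>\<close>] by simp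
    then show ?thesis using sub[OF inv_mem[OF \<open>k \<in> \<Gamma>\<close>] A] by blast
  qed
  then show ?thesis using sub[OF \<open>k \<in> \<Gamma>\<close>] by blast
qed

text \<open>An open neighbourhood of the closed condition that \<open>F\<close> be minimal at \<open>g b\<close>: only finitely many orbit
  points enter, and the strict inequality with slack \<open>1\<close> survives small perturbations.\<close>

definition almost_minimal :: "real \<Rightarrow> ('a \<Rightarrow> 'a) \<Rightarrow> ('a \<times> 'a \<Rightarrow> real) set set" where
  "almost_minimal R g = {A \<in> horo_compactification max_dist.
     \<forall>k\<in>{k \<in> \<Gamma>. dist (k b) (g b) \<le> R}. orbit_diff A g k < 1}"

lemma openin_almost_minimal: "openin max_topology (almost_minimal R g)"
proof -
  let ?G = "{k \<in> \<Gamma>. dist (k b) (g b) \<le> R}"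
  have "almost_minimal R g = (\<Inter>k\<in>?G. {A \<in> topspace max_topology. orbit_diff A g k \<in> {..<1}}) \<inter> topspace max_topology"
    by (auto simp: almost_minimal_def topspace_horo_topology)
  moreover have "openin max_topology \<dots>"
    unfolding orbit_diff_def horo_topology_def
    by (intro openin_INT finite_near openin_continuous_map_preimage[where Y=euclideanreal]
        continuous_map_from_subtopology continuous_map_class_diff metric_max_dist) auto
  ultimately show ?thesis by simp
qed

text \<open>With \<open>R\<close> and \<open>C\<close> from \<open>local_minimum_global\<close>, the sets \<open>almost_minimal R g\<close> are contained in
  \<open>domain\<close>, and each point of \<open>domain\<close> lies in the one belonging to a minimum.\<close>

lemma domain_almost_minimal:
  obtains R C where "domain = (\<Union>g\<in>\<Gamma>. almost_minimal R g)"
    "\<And>A g h. A \<in> almost_minimal R g \<Longrightarrow> g \<in> \<Gamma> \<Longrightarrow> h \<in> \<Gamma> \<Longrightarrow> orbit_diff A g h \<le> C - dist (g b) (h b)"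
proof -
  obtain R C where RC: "\<And>A g h. A \<in> horo_compactification max_dist \<Longrightarrow> g \<in> \<Gamma> \<Longrightarrow> h \<in> \<Gamma> \<Longrightarrow>
      (\<And>k. k \<in> \<Gamma> \<Longrightarrow> dist (k b) (g b) \<le> R \<Longrightarrow> orbit_diff A g k \<le> 1) \<Longrightarrow>
      orbit_diff A g h \<le> C - dist (g b) (h b)" using local_minimum_global by blast
  have grow: "orbit_diff A g h \<le> C - dist (g b) (h b)"
    if "A \<in> almost_minimal R g" "g \<in> \<Gamma>" "h \<in> \<Gamma>" for A g h
    by (rule RC) (use that in \<open>auto simp: almost_minimal_def less_imp_le\<close>)
  have "domain = (\<Union>g\<in>\<Gamma>. almost_minimal R g)"
  proof
    show "domain \<subseteq> (\<Union>g\<in>\<Gamma>. almost_minimal R g)"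
    proof
      fix A assume "A \<in> domain"
      then obtain g where g: "A \<in> horo_compactification max_dist" "g \<in> \<Gamma>" "\<And>h. h \<in> \<Gamma> \<Longrightarrow> orbit_diff A g h \<le> 0"
        by (auto simp: domain_def)
      have "orbit_diff A g k < 1" if "k \<in> \<Gamma>" for k using g(3)[OF that] by simp
      then show "A \<in> (\<Union>g\<in>\<Gamma>. almost_minimal R g)" using g(1,2) by (auto simp: almost_minimal_def)
    qed
    show "(\<Union>g\<in>\<Gamma>. almost_minimal R g) \<subseteq> domain"
    proof clarify
      fix A g assume "g \<in> \<Gamma>" "A \<in> almost_minimal R g"
      then show "A \<in> domain" by (intro domainI[of A g C] grow) (auto simp: almost_minimal_def)
    qed
  qed
  then show ?thesis using that grow by blast
qed

lemma openin_domain: "openin max_topology domain"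
proof -
  obtain R where "domain = (\<Union>g\<in>\<Gamma>. almost_minimal R g)" using domain_almost_minimal by metis
  then show ?thesis using openin_almost_minimal by auto
qed

lemma almost_minimal_act:
  assumes A: "A \<in> almost_minimal R g" and k: "k \<in> \<Gamma>"
  shows "diag_act k A \<in> almost_minimal R (k \<circ> g)"
proof -
  have Ac: "A \<in> horo_compactification max_dist" using A by (auto simp: almost_minimal_def)
  then have Ar: "A \<in> range mod_const" using compactification_range by blast
  have "orbit_diff (diag_act k A) (k \<circ> g) h < 1" if h: "h \<in> \<Gamma>" "dist (h b) ((k \<circ> g) b) \<le> R" for h
  proof -
    have kh: "h = k \<circ> (inv k \<circ> h)" using k by (simp add: fun_eq_iff)
    have "dist ((inv k \<circ> h) b) (g b) \<le> R"
      using h(2) iso[OF k, of "(inv k \<circ> h) b" "g b"] k by simp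
    then show ?thesis
      using A comp_mem[OF inv_mem[OF k] h(1)] orbit_diff_act[OF Ar k, of g "inv k \<circ> h"] kh
      by (simp add: almost_minimal_def)
  qed
  then show ?thesis
    using Ac diag_act_compactification[OF k] by (auto simp: almost_minimal_def)
qed

text \<open>A compact set is covered by finitely many of the sets \<open>almost_minimal R g\<close>. If \<open>k\<close> maps a point of the one
  belonging to \<open>g\<close> into the one belonging to \<open>h\<close>, then the image is almost minimal at \<open>k (g b)\<close>
  and at \<open>h b\<close>; adding the two growth estimates gives \<open>dist (k (g b)) (h b) \<le> C\<close>.\<close>

lemma properly_discontinuous_domain: "properly_discontinuous (subtopology max_topology domain) \<Gamma> diag_act"
  unfolding properly_discontinuous_def
proof (intro allI impI)
  fix K assume "compactin (subtopology max_topology domain) K"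
  then have K: "compactin max_topology K" "K \<subseteq> domain" by (auto simp: compactin_subtopology)
  obtain R C where dom: "domain = (\<Union>g\<in>\<Gamma>. almost_minimal R g)"
    and grow: "\<And>A g h. A \<in> almost_minimal R g \<Longrightarrow> g \<in> \<Gamma> \<Longrightarrow> h \<in> \<Gamma> \<Longrightarrow> orbit_diff A g h \<le> C - dist (g b) (h b)"
    using domain_almost_minimal by metis
  obtain \<F> where \<F>: "finite \<F>" "\<F> \<subseteq> almost_minimal R ` \<Gamma>" "K \<subseteq> \<Union>\<F>"
    using compactinD[OF K(1), of "almost_minimal R ` \<Gamma>"] openin_almost_minimal K(2) dom by auto
  then obtain G where G: "finite G" "G \<subseteq> \<Gamma>" "\<F> = almost_minimal R ` G"
    by (meson finite_subset_image)
  have "{k \<in> \<Gamma>. diag_act k ` K \<inter> K \<noteq> {}} \<subseteq> (\<Union>g\<in>G. \<Union>h\<in>G. {k \<in> \<Gamma>. dist (k (g b)) (h b) \<le> C})"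
  proof
    fix k assume "k \<in> {k \<in> \<Gamma>. diag_act k ` K \<inter> K \<noteq> {}}"
    then obtain A where k: "k \<in> \<Gamma>" and A: "A \<in> K" "diag_act k A \<in> K" by blast
    obtain g h where gh: "g \<in> G" "A \<in> almost_minimal R g" "h \<in> G" "diag_act k A \<in> almost_minimal R h"
      using \<F>(3) A G(3) by blast
    then have gh\<Gamma>: "g \<in> \<Gamma>" "h \<in> \<Gamma>" using G(2) by auto
    let ?B = "diag_act k A"
    have "?B \<in> range mod_const" using gh(4) compactification_range by (auto simp: almost_minimal_def)
    then have "orbit_diff ?B (k \<circ> g) h + orbit_diff ?B h (k \<circ> g) = 0"
      using orbit_diff_chain[of ?B "k \<circ> g" h "k \<circ> g"] orbit_diff_chain[of ?B "k \<circ> g" "k \<circ> g" "k \<circ> g"] by simp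
    moreover have "orbit_diff ?B (k \<circ> g) h \<le> C - dist ((k \<circ> g) b) (h b)"
      by (rule grow[OF almost_minimal_act[OF gh(2) k] comp_mem[OF k gh\<Gamma>(1)] gh\<Gamma>(2)])
    moreover have "orbit_diff ?B h (k \<circ> g) \<le> C - dist (h b) ((k \<circ> g) b)"
      by (rule grow[OF gh(4) gh\<Gamma>(2) comp_mem[OF k gh\<Gamma>(1)]])
    ultimately have "dist (k (g b)) (h b) \<le> C" by (simp add: dist_commute)
    then show "k \<in> (\<Union>g\<in>G. \<Union>h\<in>G. {k \<in> \<Gamma>. dist (k (g b)) (h b) \<le> C})" using gh k by blast
  qed
  then show "finite {k \<in> \<Gamma>. diag_act k ` K \<inter> K \<noteq> {}}"
    by (rule finite_subset) (use G(1) finite_near in blast)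
qed

text \<open>The compact set is a Dirichlet domain: the classes whose \<open>F\<close> is minimal at \<open>b\<close>. Moving a minimum to
  \<open>b\<close> shows that its translates cover.\<close>

lemma cocompact_domain: "cocompact (subtopology max_topology domain) \<Gamma> diag_act"
  unfolding cocompact_def
proof (intro exI conjI)
  let ?D = "{A \<in> horo_compactification max_dist. \<forall>h\<in>\<Gamma>. orbit_diff A id h \<le> 0}"
  have D: "?D \<subseteq> domain" using id_mem by (auto simp: domain_def)
  have "closedin max_topology (\<Inter>h\<in>\<Gamma>. {A \<in> topspace max_topology. orbit_diff A id h \<in> {..0}})"
    unfolding orbit_diff_def horo_topology_def
    by (intro closedin_INT closedin_continuous_map_preimage[where Y=euclideanreal]
        continuous_map_from_subtopology continuous_map_class_diff metric_max_dist) (use id_mem in auto)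
  moreover have "?D = (\<Inter>h\<in>\<Gamma>. {A \<in> topspace max_topology. orbit_diff A id h \<in> {..0}})"
    using id_mem by (auto simp: topspace_horo_topology)
  moreover have "compactin max_topology (horo_compactification max_dist)"
    unfolding horo_topology_def compactin_subtopology
    using compactin_horo_compactification[OF metric_max_dist] by simp
  ultimately have "compactin max_topology ?D"
    by (metis (no_types, lifting) closed_compactin mem_Collect_eq subsetI)
  then show "compactin (subtopology max_topology domain) ?D"
    using D by (simp add: compactin_subtopology)
  have "domain \<subseteq> topspace max_topology" using openin_domain by (rule openin_subset)
  then have ts: "topspace (subtopology max_topology domain) = domain" by auto
  show "(\<Union>g\<in>\<Gamma>. diag_act g ` ?D) = topspace (subtopology max_topology domain)"
    unfolding ts
  proof
    show "(\<Union>g\<in>\<Gamma>. diag_act g ` ?D) \<subseteq> domain" using D diag_act_domain by blast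
    show "domain \<subseteq> (\<Union>g\<in>\<Gamma>. diag_act g ` ?D)"
    proof
      fix A assume "A \<in> domain"
      then obtain g where Ac: "A \<in> horo_compactification max_dist" and g: "g \<in> \<Gamma>" "\<And>h. h \<in> \<Gamma> \<Longrightarrow> orbit_diff A g h \<le> 0"
        by (auto simp: domain_def)
      have Ar: "A \<in> range mod_const" using Ac compactification_range by blast
      have ig: "inv g \<circ> g = id" using g(1) by (simp add: fun_eq_iff)
      have "orbit_diff (diag_act (inv g) A) id h \<le> 0" if h: "h \<in> \<Gamma>" for h
      proof -
        have "inv g \<circ> (g \<circ> h) = h" using g(1) by (simp add: fun_eq_iff)
        then show ?thesis
          using orbit_diff_act[OF Ar inv_mem[OF g(1)], of g "g \<circ> h"] ig g(2)[OF comp_mem[OF g(1) h]] by simp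
      qed
      moreover have "diag_act (inv g) A \<in> horo_compactification max_dist"
        using Ac diag_act_compactification[OF inv_mem[OF g(1)]] by blast
      ultimately have "diag_act (inv g) A \<in> ?D" by simp
      moreover have "A = diag_act g (diag_act (inv g) A)" using diag_act_inv(1)[OF g(1) Ar] by simp
      ultimately show "A \<in> (\<Union>g\<in>\<Gamma>. diag_act g ` ?D)" using g(1) by blast
    qed
  qed
qed

text \<open>For a class outside \<open>domain\<close> no orbit point is an almost minimum, so from each one the value of \<open>F\<close> can
  be lowered by more than \<open>1\<close>.\<close>

lemma unbounded_below_outside_domain:
  assumes A: "A \<in> horo_compactification max_dist" "A \<notin> domain"
  shows "\<exists>g\<in>\<Gamma>. orbit_diff A g id \<le> - real n"
proof (induction n)
  case 0
  have "orbit_diff A id id \<le> - real 0" by (simp add: orbit_diff_def class_diff_def)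
  then show ?case using id_mem by (rule bexI)
next
  case (Suc n)
  then obtain g where g: "g \<in> \<Gamma>" "orbit_diff A g id \<le> - real n" by blast
  have Ar: "A \<in> range mod_const" using A compactification_range by blast
  obtain R C where RC: "\<And>A g h. A \<in> horo_compactification max_dist \<Longrightarrow> g \<in> \<Gamma> \<Longrightarrow> h \<in> \<Gamma> \<Longrightarrow>
      (\<And>k. k \<in> \<Gamma> \<Longrightarrow> dist (k b) (g b) \<le> R \<Longrightarrow> orbit_diff A g k \<le> 1) \<Longrightarrow>
      orbit_diff A g h \<le> C - dist (g b) (h b)" using local_minimum_global by blast
  have "\<exists>k\<in>\<Gamma>. 1 < orbit_diff A g k"
  proof (rule ccontr)
    assume "\<not> ?thesis"
    then have "A \<in> domain" using A(1) g(1) by (intro domainI[of A g C] RC) (auto simp: not_less)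
    then show False using A(2) by simp
  qed
  then obtain k where "k \<in> \<Gamma>" "1 < orbit_diff A g k" by blast
  moreover have "orbit_diff A g k + orbit_diff A k id = orbit_diff A g id"
    by (rule orbit_diff_chain[OF Ar])
  ultimately have "orbit_diff A k id \<le> - real (Suc n)" using g(2) by linarith
  then show ?case using \<open>k \<in> \<Gamma>\<close> by (rule bexI)
qed

end

section \<open>Horofunctions that are unbounded below\<close>

definition horofunction_of :: "(nat \<Rightarrow> 'a::metric_space) \<Rightarrow> ('a \<Rightarrow> real) \<Rightarrow> bool" where
  "horofunction_of W u \<longleftrightarrow> (\<forall>p q. (\<lambda>n. dist (W n) p - dist (W n) q) \<longlonglongrightarrow> u p - u q)"

lemma horofunction_ofD: "horofunction_of W u \<Longrightarrow> (\<lambda>n. dist (W n) p - dist (W n) q) \<longlonglongrightarrow> u p - u q"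
  by (simp add: horofunction_of_def)

lemma horofunction_of_nonexpanding: "u p - u q \<le> dist p q" if "horofunction_of W u"
proof (rule tendsto_upperbound[OF horofunction_ofD[OF that]])
  have "dist (W n) p - dist (W n) q \<le> dist p q" for n
    using dist_triangle[of "W n" p q] by (simp add: dist_commute)
  then show "\<forall>\<^sub>F n in sequentially. dist (W n) p - dist (W n) q \<le> dist p q" by simp
qed simp

lemma gromov_product_ge: "B \<le> gromov_product b x p" if "dist x p \<le> dist x b - B"
  using that dist_triangle[of x b p] by (simp add: gromov_product_def dist_commute field_simps)

text \<open>The hypothesis says that both sequences converge to the same boundary point: by \<open>gromov_product_ge\<close> the
  point \<open>p\<close> has Gromov product at least \<open>B\<close> with \<open>W n\<close> and with \<open>W' n\<close>, so the latter have large Gromov product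
  with each other. Hence their normalised distance functions are uniformly close on balls, which
  makes them Cauchy with the same limit.\<close>

lemma common_horofunction:
  fixes W W' :: "nat \<Rightarrow> 'a::metric_space"
  assumes CAT: "CAT_minus1 (UNIV :: 'a set) dist"
    and near: "\<And>B. \<exists>p. (\<forall>\<^sub>F n in sequentially. dist (W n) p \<le> dist (W n) b - B) \<and>
      (\<forall>\<^sub>F n in sequentially. dist (W' n) p \<le> dist (W' n) b - B)"
  obtains u where "horofunction_of W u" "horofunction_of W' u"
proof -
  define a where "a = (\<lambda>z n. dist (W n) z - dist (W n) b)"
  define a' where "a' = (\<lambda>z n. dist (W' n) z - dist (W' n) b)"
  have close: "\<exists>N. \<forall>m\<ge>N. \<forall>n\<ge>N. \<bar>a z m - a' z n\<bar> \<le> e" if e: "0 < e" for z e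
  proof -
    obtain T where T: "\<And>c x y z' :: 'a. T \<le> gromov_product c x y \<Longrightarrow> dist c z' \<le> dist b z \<Longrightarrow>
        \<bar>(dist x z' - dist x c) - (dist y z' - dist y c)\<bar> \<le> e"
      using CAT_minus1_busemann_close[OF CAT e] by blast
    obtain p where "\<forall>\<^sub>F n in sequentially. dist (W n) p \<le> dist (W n) b - (T + 1)"
      "\<forall>\<^sub>F n in sequentially. dist (W' n) p \<le> dist (W' n) b - (T + 1)"
      using near[of "T + 1"] by blast
    then obtain N where N: "\<And>n. N \<le> n \<Longrightarrow> dist (W n) p \<le> dist (W n) b - (T + 1)"
      "\<And>n. N \<le> n \<Longrightarrow> dist (W' n) p \<le> dist (W' n) b - (T + 1)"
      using eventually_conj unfolding eventually_sequentially by (metis le_cases order_trans)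
    have "\<bar>a z m - a' z n\<bar> \<le> e" if "N \<le> m" "N \<le> n" for m n
    proof -
      have "T + 1 \<le> gromov_product b (W m) p" "T + 1 \<le> gromov_product b p (W' n)"
        using gromov_product_ge[OF N(1)[OF that(1)]] gromov_product_ge[OF N(2)[OF that(2)]]
        by (simp_all add: gromov_product_commute)
      then have "T \<le> gromov_product b (W m) (W' n)"
        using CAT_minus1_gromov_hyperbolic[OF CAT, of b "W m" p "W' n"] by linarith
      then show ?thesis unfolding a_def a'_def by (rule T) simp
    qed
    then show ?thesis by blast
  qed
  have "Cauchy (a z)" for z
  proof (rule metric_CauchyI)
    fix e :: real assume e: "0 < e"
    obtain N where N: "\<And>m n. N \<le> m \<Longrightarrow> N \<le> n \<Longrightarrow> \<bar>a z m - a' z n\<bar> \<le> e / 3"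
      using close[of "e / 3" z] e by auto
    have "dist (a z m) (a z n) < e" if "N \<le> m" "N \<le> n" for m n
      using N[OF that(1) order_refl] N[OF that(2) order_refl] e unfolding dist_real_def by linarith
    then show "\<exists>M. \<forall>m\<ge>M. \<forall>n\<ge>M. dist (a z m) (a z n) < e" by blast
  qed
  then have u: "a z \<longlonglongrightarrow> lim (a z)" for z
    by (simp add: Cauchy_convergent_iff convergent_LIMSEQ_iff)
  have null: "(\<lambda>n. a z n - a' z n) \<longlonglongrightarrow> 0" for z
  proof (rule metric_LIMSEQ_I)
    fix e :: real assume e: "0 < e"
    obtain N where "\<And>m n. N \<le> m \<Longrightarrow> N \<le> n \<Longrightarrow> \<bar>a z m - a' z n\<bar> \<le> e / 2"
      using close[of "e / 2" z] e by auto
    then show "\<exists>N. \<forall>n\<ge>N. dist (a z n - a' z n) 0 < e"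
      using e by (intro exI[of _ N]) (fastforce simp: dist_real_def)
  qed
  have u': "a' z \<longlonglongrightarrow> lim (a z)" for z
    using tendsto_diff[OF u[of z] null[of z]]
    by simp
  have "horofunction_of W (\<lambda>z. lim (a z))" "horofunction_of W' (\<lambda>z. lim (a z))"
    unfolding horofunction_of_def
    using tendsto_diff[OF u u] tendsto_diff[OF u' u'] by (auto simp: a_def a'_def)
  then show ?thesis using that by blast
qed

lemma horofunction_of_eventually:
  assumes "horofunction_of W u" "u p \<le> u b - (B + 1)"
  shows "\<forall>\<^sub>F n in sequentially. dist (W n) p \<le> dist (W n) b - B"
proof -
  have "u p - u b < - B" using assms(2) by simp
  from order_tendstoD(2)[OF horofunction_ofD[OF assms(1)] this]
  show ?thesis by eventually_elim simp
qed

text \<open>Two horofunctions that tend to minus infinity along the same points belong to the same boundary point.\<close>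

lemma horofunction_unique:
  fixes W W' :: "nat \<Rightarrow> 'a::metric_space"
  assumes CAT: "CAT_minus1 (UNIV :: 'a set) dist"
    and u: "horofunction_of W u" and u': "horofunction_of W' u'"
    and near: "\<And>B. \<exists>p. u p \<le> u b - B \<and> u' p \<le> u' b - B"
  shows "u p - u q = u' p - u' q"
proof -
  obtain v where v: "horofunction_of W v" "horofunction_of W' v"
  proof (rule common_horofunction[OF CAT, of W b W'])
    show "\<exists>p. (\<forall>\<^sub>F n in sequentially. dist (W n) p \<le> dist (W n) b - B) \<and>
      (\<forall>\<^sub>F n in sequentially. dist (W' n) p \<le> dist (W' n) b - B)" for B
      using near[of "B + 1"] horofunction_of_eventually[OF u] horofunction_of_eventually[OF u'] by blast
  qed
  show ?thesis
    using LIMSEQ_unique[OF horofunction_ofD[OF u] horofunction_ofD[OF v(1)]]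
      LIMSEQ_unique[OF horofunction_ofD[OF u'] horofunction_ofD[OF v(2)]] by metis
qed

text \<open>The way in which a boundary function depends on its two coordinates. Equivariance under simultaneous
  translation is what lets isometries act on \<open>\<Phi> (u x) (u y)\<close> through \<open>u\<close> modulo constants.\<close>

definition equivariant_join :: "(real \<Rightarrow> real \<Rightarrow> real) \<Rightarrow> bool" where
  "equivariant_join \<Phi> \<longleftrightarrow> (\<forall>s s' t t'. s \<le> s' \<longrightarrow> t \<le> t' \<longrightarrow> \<Phi> s t \<le> \<Phi> s' t') \<and>
    (\<forall>s t c. \<Phi> (s + c) (t + c) = \<Phi> s t + c)"

text \<open>If \<open>X n\<close> escapes much faster than \<open>Y n\<close>, the first coordinate realises the maximum at every given point
  from some index on.\<close>

lemma one_factor_limit: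
  fixes X Y :: "nat \<Rightarrow> 'a::metric_space"
  assumes XY: "\<And>p q. (\<lambda>n. max_dist (X n, Y n) p - max_dist (X n, Y n) q) \<longlonglongrightarrow> f p - f q"
    and far: "\<And>K. \<forall>\<^sub>F n in sequentially. K \<le> dist (X n) b - dist (Y n) b"
  shows "horofunction_of X (\<lambda>x. f (x, b))" "f (x, y) = f (x, b)"
proof -
  have first: "\<forall>\<^sub>F n in sequentially. max_dist (X n, Y n) (x, y) = dist (X n) x" for x y
    using far[of "dist b x + dist b y"]
  proof eventually_elim
    case (elim n)
    then have "dist (Y n) y \<le> dist (X n) x"
      using dist_triangle[of "Y n" y b] dist_triangle[of "X n" b x] dist_commute[of b x] by linarith
    then show ?case by (simp add: max_dist_def)
  qed
  have lim: "(\<lambda>n. dist (X n) x - dist (X n) x') \<longlonglongrightarrow> f (x, y) - f (x', y')" for x y x' y'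
    by (rule Lim_transform_eventually[OF XY[of "(x, y)" "(x', y')"]])
      (use first[of x y] first[of x' y'] in eventually_elim, simp)
  show "horofunction_of X (\<lambda>x. f (x, b))" unfolding horofunction_of_def using lim by blast
  show "f (x, y) = f (x, b)" using LIMSEQ_unique[OF lim[of x x y b] lim[of x x b b]] by simp
qed

text \<open>After passing to a subsequence, \<open>dist (X n) b - dist (Y n) b\<close> converges in the extended reals. If the
  limit is infinite, only one coordinate matters. If it is a real number \<open>c\<close>, both sequences converge to
  the boundary point towards which \<open>f\<close> decreases on the diagonal, so they have the same horofunction \<open>u\<close>, and
  \<open>f\<close> is \<open>max (u x + c) (u y)\<close> up to constants.\<close>

lemma horofunction_join:
  fixes f :: "'a::heine_borel \<times> 'a \<Rightarrow> real" and b :: 'a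
  assumes CAT: "CAT_minus1 (UNIV :: 'a set) dist"
    and f: "mod_const f \<in> horo_compactification max_dist"
    and unbounded: "\<And>B. \<exists>p. f (p, p) \<le> f (b, b) - B"
  obtains W u \<Phi> where "horofunction_of W u" "equivariant_join \<Phi>" "\<And>x y. f (x, y) = \<Phi> (u x) (u y)"
proof -
  obtain X0 Y0 where XY0: "\<And>p q. (\<lambda>n. max_dist (X0 n, Y0 n) p - max_dist (X0 n, Y0 n) q) \<longlonglongrightarrow> f p - f q"
    using horo_sequence[OF f] by blast
  obtain l r where r: "strict_mono r" "((\<lambda>n. ereal (dist (X0 n) b - dist (Y0 n) b)) \<circ> r) \<longlonglongrightarrow> l"
    using compact_complete_linorder by blast
  define X Y where "X = X0 \<circ> r" and "Y = Y0 \<circ> r"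
  have XY: "(\<lambda>n. max_dist (X n, Y n) p - max_dist (X n, Y n) q) \<longlonglongrightarrow> f p - f q" for p q
    using LIMSEQ_subseq_LIMSEQ[OF XY0 r(1)] by (simp add: X_def Y_def comp_def)
  have l: "(\<lambda>n. ereal (dist (X n) b - dist (Y n) b)) \<longlonglongrightarrow> l"
    using r(2) by (simp add: X_def Y_def comp_def)
  show ?thesis
  proof (cases l)
    case PInf
    have far: "\<forall>\<^sub>F n in sequentially. K \<le> dist (X n) b - dist (Y n) b" for K
      using order_tendstoD(1)[OF l, of "ereal K"] PInf by (auto elim!: eventually_mono)
    show ?thesis
      using one_factor_limit[OF XY far] by (intro that[of X "\<lambda>x. f (x, b)" "\<lambda>s t. s"]) (auto simp: equivariant_join_def)
  next
    case MInf
    have far: "\<forall>\<^sub>F n in sequentially. K \<le> dist (Y n) b - dist (X n) b" for K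
    proof -
      have "\<forall>\<^sub>F n in sequentially. ereal (dist (X n) b - dist (Y n) b) < ereal (- K)"
        using order_tendstoD(2)[OF l, of "ereal (- K)"] MInf by simp
      then show ?thesis by eventually_elim simp
    qed
    have swap: "max_dist (Y n, X n) p = max_dist (X n, Y n) (snd p, fst p)" for n p
      by (simp add: max_dist_def max.commute)
    have YX: "(\<lambda>n. max_dist (Y n, X n) p - max_dist (Y n, X n) q) \<longlonglongrightarrow> f (snd p, fst p) - f (snd q, fst q)" for p q
      unfolding swap by (rule XY)
    note o = one_factor_limit[of Y X "\<lambda>p. f (snd p, fst p)", OF YX far, simplified]
    show ?thesis
      using o by (intro that[of Y "\<lambda>y. f (b, y)" "\<lambda>s t. t"]) (auto simp: equivariant_join_def)
  next
    case (real c)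
    have c: "(\<lambda>n. dist (X n) b - dist (Y n) b) \<longlonglongrightarrow> c" using l real by simp
    have near: "\<exists>p. (\<forall>\<^sub>F n in sequentially. dist (X n) p \<le> dist (X n) b - B) \<and>
      (\<forall>\<^sub>F n in sequentially. dist (Y n) p \<le> dist (Y n) b - B)" for B
    proof -
      obtain p where "f (p, p) \<le> f (b, b) - (B + \<bar>c\<bar> + 2)" using unbounded by blast
      then have "f (p, p) - f (b, b) < - (B + \<bar>c\<bar> + 1)" by simp
      then have "\<forall>\<^sub>F n in sequentially. max_dist (X n, Y n) (p, p) - max_dist (X n, Y n) (b, b) < - (B + \<bar>c\<bar> + 1)"
        by (rule order_tendstoD(2)[OF XY])
      moreover have "\<forall>\<^sub>F n in sequentially. c - 1 < dist (X n) b - dist (Y n) b"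
        by (rule order_tendstoD(1)[OF c]) simp
      moreover have "\<forall>\<^sub>F n in sequentially. dist (X n) b - dist (Y n) b < c + 1"
        by (rule order_tendstoD(2)[OF c]) simp
      ultimately have "\<forall>\<^sub>F n in sequentially. dist (X n) p \<le> dist (X n) b - B \<and> dist (Y n) p \<le> dist (Y n) b - B"
      proof eventually_elim
        case (elim n)
        then show ?case unfolding max_dist_def fst_conv snd_conv by linarith
      qed
      then show ?thesis unfolding eventually_conj_iff by blast
    qed
    obtain u where u: "horofunction_of X u" "horofunction_of Y u"
      using common_horofunction[OF CAT near] by blast
    define \<Phi> where "\<Phi> = (\<lambda>s t. max (s - u b + c) (t - u b) - max c 0 + f (b, b))"
    have "f (x, y) = \<Phi> (u x) (u y)" for x y
    proof -
      have lim: "(\<lambda>n. max ((dist (X n) x - dist (X n) b) + (dist (X n) b - dist (Y n) b)) (dist (Y n) y - dist (Y n) b) -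
          max (dist (X n) b - dist (Y n) b) 0) \<longlonglongrightarrow> max ((u x - u b) + c) (u y - u b) - max c 0"
        by (intro tendsto_diff[OF tendsto_max[OF tendsto_add]] tendsto_max c tendsto_const
            horofunction_ofD[OF u(1)] horofunction_ofD[OF u(2)])
      have eq: "(\<lambda>n. max ((dist (X n) x - dist (X n) b) + (dist (X n) b - dist (Y n) b)) (dist (Y n) y - dist (Y n) b) -
          max (dist (X n) b - dist (Y n) b) 0) = (\<lambda>n. max_dist (X n, Y n) (x, y) - max_dist (X n, Y n) (b, b))"
        by (rule ext) (simp add: max_dist_def max_def)
      have "f (x, y) - f (b, b) = max ((u x - u b) + c) (u y - u b) - max c 0"
        using lim unfolding eq by (rule LIMSEQ_unique[OF XY])
      then show ?thesis unfolding \<Phi>_def by linarith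
    qed
    moreover have "equivariant_join \<Phi>"
      unfolding equivariant_join_def \<Phi>_def by (auto simp: max_def)
    ultimately show ?thesis using that[OF u(1)] by blast
  qed
qed

context quasi_convex_action begin

lemma horofunction_of_act: "horofunction_of (g \<circ> W) (u \<circ> inv g)" if "horofunction_of W u" "g \<in> \<Gamma>"
proof -
  have "dist (g x) p = dist x (inv g p)" for x p
    using iso[OF that(2), of x "inv g p"] that(2) by simp
  then show ?thesis using that(1) by (simp add: horofunction_of_def)
qed

text \<open>Choose \<open>G k\<close> in \<open>\<Gamma>\<close> with \<open>u (G k b) \<le> u b - k\<close>, so that \<open>G k b\<close> converges to the boundary point \<open>\<xi>\<close> of \<open>u\<close>.
  Typically \<open>G k\<close> maps everything except a neighbourhood of the limit of \<open>(G k)\<inverse> b\<close> close to \<open>\<xi>\<close>, and it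
  moves \<open>u\<close> towards itself unless this limit is \<open>\<xi>\<close>. To avoid the exception, \<open>G k \<circ> h\<close> is
  used instead. The quantity \<open>val h k\<close> is, up to bounded terms, twice the difference of
  \<open>dist (G k b) b\<close> and the Gromov product of \<open>h \<xi>\<close> with \<open>(G k)\<inverse> b\<close>. If for some \<open>h\<close> it takes arbitrarily
  large values at arbitrarily large \<open>k\<close>, then these \<open>G k \<circ> h\<close> move \<open>u\<close> towards itself. If there is no such
  \<open>h\<close>, then \<open>u\<close> and every translate \<open>u \<circ> inv h\<close> tend to minus infinity along \<open>(G k)\<inverse> b\<close>, so they agree
  up to constants.\<close>

lemma horofunction_fixed_or_recurrent:
  assumes u: "horofunction_of W u" and unbounded: "\<And>n. \<exists>g\<in>\<Gamma>. u (g b) \<le> u b - real n"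
  shows "(\<forall>h\<in>\<Gamma>. \<forall>p q. u (inv h p) - u (inv h q) = u p - u q) \<or>
    (\<forall>n. \<exists>\<gamma>\<in>\<Gamma>. real n \<le> dist (\<gamma> b) b \<and>
      (\<exists>c. \<forall>z. dist b z \<le> real n \<longrightarrow> \<bar>u (inv \<gamma> z) - u z - c\<bar> \<le> 1 / real (Suc n)))"
proof -
  obtain G where G: "\<And>k. G k \<in> \<Gamma>" "\<And>k. u (G k b) \<le> u b - real k" using unbounded by metis
  define val where "val = (\<lambda>h k. dist (G k b) b + u (inv h (inv (G k) b)))"
  have far: "real k \<le> dist (G k b) b" for k
    using horofunction_of_nonexpanding[OF u, of b "G k b"] G(2)[of k] by (simp add: dist_commute)
  show ?thesis
  proof (cases "\<exists>h\<in>\<Gamma>. \<forall>B K. \<exists>k\<ge>K. B \<le> val h k")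
    case True
    then obtain h where h: "h \<in> \<Gamma>" "\<And>B K. \<exists>k\<ge>K. B \<le> val h k" by blast
    have "\<exists>\<gamma>\<in>\<Gamma>. real n \<le> dist (\<gamma> b) b \<and>
      (\<exists>c. \<forall>z. dist b z \<le> real n \<longrightarrow> \<bar>u (inv \<gamma> z) - u z - c\<bar> \<le> 1 / real (Suc n))" for n
    proof -
      define e where "e = 1 / real (Suc n)"
      have e: "0 < e" by (simp add: e_def)
      obtain T where T: "\<And>c x y z :: 'a. T \<le> gromov_product c x y \<Longrightarrow> dist c z \<le> real n \<Longrightarrow>
          \<bar>(dist x z - dist x c) - (dist y z - dist y c)\<bar> \<le> e"
        using CAT_minus1_busemann_close[OF CAT e] by blast
      define H where "H = dist (h b) b"
      obtain K where K: "\<bar>T\<bar> + 3 + H + real n \<le> real K" using real_arch_simple by blast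
      obtain k where k: "K \<le> k" "2 * T + 5 + u b + H \<le> val h k" using h(2) by blast
      have kR: "\<bar>T\<bar> + 3 + H + real n \<le> real k" using K k(1) by linarith
      have H0: "0 \<le> H" by (simp add: H_def)
      define \<gamma> where "\<gamma> = G k \<circ> h"
      have \<gamma>: "\<gamma> \<in> \<Gamma>" unfolding \<gamma>_def by (rule comp_mem[OF G(1) h(1)])
      have inv\<gamma>: "inv \<gamma> z = inv h (inv (G k) z)" for z
        unfolding \<gamma>_def using o_inv_distrib[OF bij[OF G(1)] bij[OF h(1)]] by simp
      have d1: "dist (\<gamma> b) (G k b) = H"
        using iso[OF G(1), of k "h b" b] by (simp add: \<gamma>_def H_def)
      have d2: "dist (G k b) b - H \<le> dist (\<gamma> b) b"
        using dist_triangle[of "G k b" b "\<gamma> b"] d1 by (simp add: dist_commute)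
      have close: "\<bar>(u (inv \<gamma> z) - u (inv \<gamma> b)) - (u z - u b)\<bar> \<le> e" if z: "dist b z \<le> real n" for z
      proof (rule tendsto_upperbound)
        have act: "dist (\<gamma> x) p = dist x (inv \<gamma> p)" for x p
          using iso[OF \<gamma>, of x "inv \<gamma> p"] \<gamma> by simp
        show "(\<lambda>l. \<bar>(dist (\<gamma> (W l)) z - dist (\<gamma> (W l)) b) - (dist (W l) z - dist (W l) b)\<bar>) \<longlonglongrightarrow>
            \<bar>(u (inv \<gamma> z) - u (inv \<gamma> b)) - (u z - u b)\<bar>"
          unfolding act by (intro tendsto_rabs tendsto_diff[where f="\<lambda>l. dist (W l) p - dist (W l) q" for p q] horofunction_ofD[OF u])
        have "\<forall>\<^sub>F l in sequentially. dist (W l) (G k b) \<le> dist (W l) b - (real k - 1)"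
          by (rule horofunction_of_eventually[OF u]) (use G(2)[of k] in simp)
        moreover have "\<forall>\<^sub>F l in sequentially. u (inv \<gamma> b) - u b - 1 < dist (W l) (inv \<gamma> b) - dist (W l) b"
          by (rule order_tendstoD(1)[OF horofunction_ofD[OF u]]) simp
        ultimately show "\<forall>\<^sub>F l in sequentially.
            \<bar>(dist (\<gamma> (W l)) z - dist (\<gamma> (W l)) b) - (dist (W l) z - dist (W l) b)\<bar> \<le> e"
        proof eventually_elim
          case (elim l)
          have "real k - 1 \<le> gromov_product b (G k b) (W l)"
            using gromov_product_ge[OF elim(1)] by (simp add: gromov_product_commute)
          \<comment> \<open>Three products of at least \<open>T + 2\<close> along \<open>\<gamma> (W l)\<close>, \<open>\<gamma> b\<close>, \<open>G k b\<close>, \<open>W l\<close>; hyperbolicity costs \<open>1\<close> at each of two steps.\<close>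
          then have 1: "T + 2 \<le> gromov_product b (G k b) (W l)" using kR H0 by linarith
          have 2: "T + 2 \<le> gromov_product b (\<gamma> b) (G k b)"
            using d1 d2 far[of k] kR H0 unfolding gromov_product_def
            by (simp add: dist_commute)
          have "dist b (\<gamma> (W l)) = dist (W l) (inv \<gamma> b)" "dist (\<gamma> (W l)) (\<gamma> b) = dist (W l) b"
            using act[of "W l" b] iso[OF \<gamma>, of "W l" b] by (simp_all add: dist_commute)
          then have 3: "T + 2 \<le> gromov_product b (\<gamma> (W l)) (\<gamma> b)"
            using elim(2) d2 k(2) unfolding gromov_product_def val_def inv\<gamma>
            by (simp add: dist_commute)
          have "T \<le> gromov_product b (\<gamma> (W l)) (W l)"
            using 1 2 3 CAT_minus1_gromov_hyperbolic[OF CAT, of b "\<gamma> (W l)" "\<gamma> b" "G k b"]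
              CAT_minus1_gromov_hyperbolic[OF CAT, of b "\<gamma> (W l)" "G k b" "W l"] by linarith
          then show ?case by (rule T[OF _ z])
        qed
      qed simp
      have "real n \<le> dist (\<gamma> b) b" using d2 far[of k] kR by linarith
      moreover have "\<forall>z. dist b z \<le> real n \<longrightarrow> \<bar>u (inv \<gamma> z) - u z - (u (inv \<gamma> b) - u b)\<bar> \<le> 1 / real (Suc n)"
        using close unfolding e_def by (simp add: algebra_simps)
      ultimately show ?thesis using \<gamma> by blast
    qed
    then show ?thesis by blast
  next
    case False
    then have bounded: "\<exists>B K. \<forall>k\<ge>K. val h k < B" if "h \<in> \<Gamma>" for h
      using that by (meson not_le)
    obtain B0 K0 where B0: "\<And>k. K0 \<le> k \<Longrightarrow> val id k < B0" using bounded[OF id_mem] by blast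
    have "u (inv h p) - u (inv h q) = u p - u q" if h: "h \<in> \<Gamma>" for h p q
    proof -
      obtain B1 K1 where B1: "\<And>k. K1 \<le> k \<Longrightarrow> val h k < B1" using bounded[OF h] by blast
      have "(u \<circ> inv h) p - (u \<circ> inv h) q = u p - u q"
      proof (rule horofunction_unique[OF CAT horofunction_of_act[OF u h] u, of b])
        fix B
        obtain K2 where K2: "B + \<bar>B0\<bar> + \<bar>B1\<bar> + \<bar>u b\<bar> + \<bar>u (inv h b)\<bar> \<le> real K2" using real_arch_simple by blast
        define k where "k = max K0 (max K1 K2)"
        have "B + \<bar>B0\<bar> + \<bar>B1\<bar> + \<bar>u b\<bar> + \<bar>u (inv h b)\<bar> \<le> dist (G k b) b"
        proof -
          have "real K2 \<le> real k" by (simp add: k_def)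
          then show ?thesis using K2 far[of k] by linarith
        qed
        moreover have "K0 \<le> k" "K1 \<le> k" by (simp_all add: k_def)
        then have "dist (G k b) b + u (inv (G k) b) < B0" "dist (G k b) b + u (inv h (inv (G k) b)) < B1"
          using B0[of k] B1[of k] by (simp_all only: val_def inv_id id_apply)
        ultimately have "(u \<circ> inv h) (inv (G k) b) \<le> (u \<circ> inv h) b - B \<and> u (inv (G k) b) \<le> u b - B"
          unfolding comp_apply by linarith
        then show "\<exists>p. (u \<circ> inv h) p \<le> (u \<circ> inv h) b - B \<and> u p \<le> u b - B" by blast
      qed
      then show ?thesis by simp
    qed
    then show ?thesis by blast
  qed
qed

section \<open>Maximality of the domain\<close>

text \<open>Monotonicity and equivariance of \<open>\<Phi>\<close> carry the estimate from \<open>u\<close> to \<open>f\<close> with the same constants.\<close>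

lemma limitin_translates:
  assumes f: "mod_const f \<in> horo_compactification max_dist"
    and \<Phi>: "equivariant_join \<Phi>" and fu: "\<And>x y. f (x, y) = \<Phi> (u x) (u y)"
    and \<gamma>: "\<And>n. \<gamma> n \<in> \<Gamma>"
    and close: "\<And>n z. dist b z \<le> real n \<Longrightarrow> \<bar>u (inv (\<gamma> n) z) - u z - c n\<bar> \<le> 1 / real (Suc n)"
  shows "limitin (cont_mod_const max_dist) (\<lambda>n. diag_act (\<gamma> n) (mod_const f)) (mod_const f) sequentially"
proof -
  have \<Phi>_mono: "s \<le> s' \<Longrightarrow> t \<le> t' \<Longrightarrow> \<Phi> s t \<le> \<Phi> s' t'"
    and \<Phi>_shift: "\<Phi> (s + c) (t + c) = \<Phi> s t + c" for s s' t t' c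
    using \<Phi> by (auto simp: equivariant_join_def)
  define F where "F = (\<lambda>n p. f (inv (\<gamma> n) (fst p), inv (\<gamma> n) (snd p)))"
  have FA: "mod_const (F n) = diag_act (\<gamma> n) (mod_const f)" for n
    by (simp add: diag_act_mod_const[OF \<gamma>] F_def)
  have Fclose: "\<bar>F n p - f p - c n\<bar> \<le> 1 / real (Suc n)"
    if "dist b (fst p) \<le> real n" "dist b (snd p) \<le> real n" for n p
  proof -
    let ?e = "1 / real (Suc n)"
    obtain x y where p: "p = (x, y)" by (cases p)
    have xy: "u (inv (\<gamma> n) x) \<le> u x + (c n + ?e)" "u x + (c n - ?e) \<le> u (inv (\<gamma> n) x)"
      "u (inv (\<gamma> n) y) \<le> u y + (c n + ?e)" "u y + (c n - ?e) \<le> u (inv (\<gamma> n) y)"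
      using close[of x n] close[of y n] that unfolding p fst_conv snd_conv by linarith+
    have "F n p \<le> f p + (c n + ?e)"
      using \<Phi>_mono[OF xy(1,3)] by (simp add: F_def p fu \<Phi>_shift)
    moreover have "f p + (c n - ?e) \<le> F n p"
      using \<Phi>_mono[OF xy(2,4)] by (simp add: F_def p fu \<Phi>_shift)
    ultimately show ?thesis by linarith
  qed
  have An: "diag_act (\<gamma> n) (mod_const f) \<in> horo_compactification max_dist" for n
    using diag_act_compactification[OF \<gamma>, of n] f by blast
  have cont: "g \<in> cont_funs max_dist" if "mod_const g \<in> horo_compactification max_dist" for g
    using nonexpanding_cont_funs[OF metric_max_dist] horo_class_nonexpanding[OF metric_max_dist that]
    by (auto simp: nonexpanding_def)
  have lim: "limitin (cont_mod_const max_dist) (\<lambda>n. mod_const (F n)) (mod_const f) sequentially"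
  proof (rule limitin_mod_const)
    show "F n \<in> cont_funs max_dist" for n
      using An[of n] by (intro cont) (simp add: FA)
    show "f \<in> cont_funs max_dist" by (rule cont[OF f])
    fix K :: "('a \<times> 'a) set" and e :: real
    assume K: "compactin max_dist.mtopology K" and e: "0 < e"
    obtain N where N: "finite N" "\<And>x. x \<in> K \<Longrightarrow> \<exists>p\<in>N. max_dist p x < 1"
      using compactin_finite_net[OF metric_max_dist K, of 1] by auto
    have "\<exists>R. \<forall>p\<in>N. max_dist (b, b) p \<le> R"
      using bdd_above_finite[OF finite_imageI[OF N(1)]] by (auto simp: bdd_above_def)
    then obtain R where R: "\<And>p. p \<in> N \<Longrightarrow> max_dist (b, b) p \<le> R" by blast
    obtain n0 where n0: "R + 1 \<le> real n0" using real_arch_simple by blast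
    obtain n1 where n1: "1 / real (Suc n1) < e" using nat_approx_posE[OF e] by blast
    show "\<forall>\<^sub>F n in sequentially. \<exists>c. \<forall>x\<in>K. \<bar>F n x - f x - c\<bar> < e"
      using eventually_ge_at_top[of "max n0 n1"]
    proof eventually_elim
      case (elim n)
      have "\<bar>F n x - f x - c n\<bar> < e" if x: "x \<in> K" for x
      proof -
        obtain p where p: "p \<in> N" "max_dist p x < 1" using N(2)[OF x] by blast
        have "max_dist (b, b) x \<le> R + 1"
          using max_dist.triangle[of "(b, b)" p x] R[OF p(1)] p(2) by simp
        then have "dist b (fst x) \<le> real n" "dist b (snd x) \<le> real n"
          using n0 elim by (auto simp: max_dist_def)
        from Fclose[OF this] have "\<bar>F n x - f x - c n\<bar> \<le> 1 / real (Suc n)" .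
        also have "\<dots> \<le> 1 / real (Suc n1)" using elim by (intro divide_left_mono) auto
        finally show ?thesis using n1 by linarith
      qed
      then show ?case by blast
    qed
  qed
  then show ?thesis by (simp only: FA)
qed

text \<open>The compact set is the limit \<open>A\<close> together with a tail of the sequence \<open>\<gamma> n A\<close>; it contains both \<open>A\<close> and
  \<open>\<gamma> n A\<close> for all large \<open>n\<close>.\<close>

lemma not_properly_discontinuous_limit:
  assumes U: "openin (subtopology max_topology max_boundary) U" and A: "A \<in> U"
    and \<gamma>: "\<And>n. \<gamma> n \<in> \<Gamma>" "\<And>n. real n \<le> dist (\<gamma> n b) b"
    and lim: "limitin (cont_mod_const max_dist) (\<lambda>n. diag_act (\<gamma> n) A) A sequentially"
  shows "\<not> properly_discontinuous (subtopology max_topology U) \<Gamma> diag_act"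
proof
  assume pd: "properly_discontinuous (subtopology max_topology U) \<Gamma> diag_act"
  obtain V where V: "openin (cont_mod_const max_dist) V" "U = V \<inter> max_boundary"
  proof -
    have "max_boundary \<subseteq> horo_compactification max_dist" by (auto simp: ideal_boundary_def)
    then show ?thesis
      using U that unfolding horo_topology_def subtopology_subtopology openin_subtopology
      by (auto simp: Int_absorb1)
  qed
  have Uc: "U \<subseteq> horo_compactification max_dist" using V by (auto simp: ideal_boundary_def)
  have An: "diag_act (\<gamma> n) A \<in> max_boundary" for n
    using diag_act_boundary[OF \<gamma>(1)] A V(2) by blast
  have "\<forall>\<^sub>F n in sequentially. diag_act (\<gamma> n) A \<in> V"
    using lim A V unfolding limitin_def by blast
  then obtain n0 where n0: "\<And>n. n0 \<le> n \<Longrightarrow> diag_act (\<gamma> n) A \<in> U"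
    using An V(2) by (auto simp: eventually_sequentially)
  define S where "S = (\<lambda>n. diag_act (\<gamma> n) A) ` {n0..}"
  have SU: "insert A S \<subseteq> U" using n0 A by (auto simp: S_def)
  have "compactin (cont_mod_const max_dist) (insert A S)"
  proof (rule compactin_sequence_with_limit)
    show "limitin (cont_mod_const max_dist) (\<lambda>n. diag_act (\<gamma> n) A) A sequentially"
      by (rule lim)
    show "S \<subseteq> range (\<lambda>n. diag_act (\<gamma> n) A)" by (auto simp: S_def)
    show "S \<subseteq> topspace (cont_mod_const max_dist)"
      using SU V openin_subset[OF V(1)] by blast
  qed
  moreover have "insert A S \<subseteq> horo_compactification max_dist" using SU Uc by (rule order_trans)
  ultimately have "compactin (subtopology max_topology U) (insert A S)"
    using SU unfolding horo_topology_def by (simp only: compactin_subtopology simp_thms)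
  then have fin: "finite {g \<in> \<Gamma>. diag_act g ` insert A S \<inter> insert A S \<noteq> {}}"
    by (rule pd[unfolded properly_discontinuous_def, rule_format])
  have mem: "\<gamma> n \<in> {g \<in> \<Gamma>. diag_act g ` insert A S \<inter> insert A S \<noteq> {}}" if "n0 \<le> n" for n
    using \<gamma>(1) that by (auto simp: S_def)
  obtain R where R: "\<And>g. g \<in> {g \<in> \<Gamma>. diag_act g ` insert A S \<inter> insert A S \<noteq> {}} \<Longrightarrow> dist (g b) b \<le> R"
    using bdd_above_finite[OF finite_imageI[OF fin, of "\<lambda>g. dist (g b) b"]] by (auto simp: bdd_above_def)
  obtain n1 where "R + 1 \<le> real n1" using real_arch_simple by blast
  then have "R + 1 \<le> real (max n0 n1)" by linarith
  moreover have "dist (\<gamma> (max n0 n1) b) b \<le> R" by (intro R mem) simp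
  ultimately show False using \<gamma>(2)[of "max n0 n1"] by linarith
qed

lemma properly_discontinuous_subset_domain:
  assumes inf: "infinite \<Gamma>" and U: "openin (subtopology max_topology max_boundary) U"
    and pd: "properly_discontinuous (subtopology max_topology U) \<Gamma> diag_act"
  shows "U \<subseteq> domain"
proof (rule ccontr)
  assume "\<not> U \<subseteq> domain"
  then obtain A where A: "A \<in> U" "A \<notin> domain" by blast
  have "U \<subseteq> max_boundary" using U by (rule openin_imp_subset)
  then have Uc: "U \<subseteq> horo_compactification max_dist" by (auto simp: ideal_boundary_def)
  then have Ac: "A \<in> horo_compactification max_dist" using A(1) by blast
  obtain f where f: "A = mod_const f" using Ac compactification_range by auto
  have unbounded: "\<exists>g\<in>\<Gamma>. f (g b, g b) \<le> f (b, b) - real n" for n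
    using unbounded_below_outside_domain[OF Ac A(2), of n] by (simp add: f orbit_diff_def algebra_simps)
  have "\<exists>p. f (p, p) \<le> f (b, b) - B" for B
  proof -
    obtain n where "B \<le> real n" using real_arch_simple by blast
    moreover obtain g where "f (g b, g b) \<le> f (b, b) - real n" using unbounded by blast
    ultimately have "f (g b, g b) \<le> f (b, b) - B" by linarith
    then show ?thesis by blast
  qed
  then obtain W u \<Phi> where u: "horofunction_of W u" and \<Phi>: "equivariant_join \<Phi>"
    and fu: "\<And>x y. f (x, y) = \<Phi> (u x) (u y)"
    using horofunction_join[OF CAT Ac[unfolded f], of b] by blast
  have \<Phi>_shift: "\<Phi> (s + c) (t + c) = \<Phi> s t + c" for s t c
    using \<Phi> by (simp add: equivariant_join_def)
  \<comment> \<open>On the diagonal \<open>f\<close> differs from \<open>u\<close> by a constant, so \<open>u\<close> is unbounded below on the orbit.\<close>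
  have "f (p, p) = \<Phi> 0 0 + u p" for p using \<Phi>_shift[of 0 "u p" 0] by (simp add: fu)
  then have u_unbounded: "\<exists>g\<in>\<Gamma>. u (g b) \<le> u b - real n" for n using unbounded[of n] by simp
  from horofunction_fixed_or_recurrent[OF u u_unbounded] show False
  proof
    assume fixed: "\<forall>h\<in>\<Gamma>. \<forall>p q. u (inv h p) - u (inv h q) = u p - u q"
    have "diag_act h A = A" if h: "h \<in> \<Gamma>" for h
    proof -
      define c where "c = u (inv h b) - u b"
      have "u (inv h p) = u p + c" for p
        using fixed[rule_format, OF h, of p b] by (simp add: c_def)
      then have "f (inv h x, inv h y) = f (x, y) + c" for x y by (simp add: fu \<Phi>_shift)
      then show ?thesis
        unfolding f diag_act_mod_const[OF h] by (intro mod_const_eqI[of _ _ c]) (simp add: split_paired_all)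
    qed
    then have "{g \<in> \<Gamma>. diag_act g ` {A} \<inter> {A} \<noteq> {}} = \<Gamma>" by auto
    moreover have "compactin (subtopology max_topology U) {A}"
      using A(1) Uc by (intro finite_imp_compactin) (auto simp: topspace_horo_topology)
    then have "finite {g \<in> \<Gamma>. diag_act g ` {A} \<inter> {A} \<noteq> {}}"
      by (rule pd[unfolded properly_discontinuous_def, rule_format])
    ultimately show False using inf by (simp only:)
  next
    assume rec: "\<forall>n. \<exists>\<gamma>\<in>\<Gamma>. real n \<le> dist (\<gamma> b) b \<and>
      (\<exists>c. \<forall>z. dist b z \<le> real n \<longrightarrow> \<bar>u (inv \<gamma> z) - u z - c\<bar> \<le> 1 / real (Suc n))"
    obtain \<gamma> c where \<gamma>: "\<And>n. \<gamma> n \<in> \<Gamma>" "\<And>n. real n \<le> dist (\<gamma> n b) b"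
      and close: "\<And>n z. dist b z \<le> real n \<Longrightarrow> \<bar>u (inv (\<gamma> n) z) - u z - c n\<bar> \<le> 1 / real (Suc n)"
      using rec by metis
    have "limitin (cont_mod_const max_dist) (\<lambda>n. diag_act (\<gamma> n) A) A sequentially"
      unfolding f by (rule limitin_translates[OF Ac[unfolded f] \<Phi> fu \<gamma>(1) close])
    then show False
      using not_properly_discontinuous_limit[OF U A(1), of \<gamma>, OF \<gamma>] pd by blast
  qed
qed

end

theorem theorem1p1:
  fixes \<Gamma> :: "('a::heine_borel \<Rightarrow> 'a) set"
  assumes "CAT_minus1 (UNIV :: 'a set) dist"
    and "quasi_convex_group \<Gamma>"
    and "infinite \<Gamma>"
  shows "\<exists>\<Omega>. openin (subtopology max_topology max_boundary) \<Omega> \<and>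
    (acts_on (subtopology max_topology (max_product \<union> \<Omega>)) \<Gamma> diag_act \<and>
     properly_discontinuous (subtopology max_topology (max_product \<union> \<Omega>)) \<Gamma> diag_act \<and>
     cocompact (subtopology max_topology (max_product \<union> \<Omega>)) \<Gamma> diag_act) \<and>
    (properly_discontinuous (subtopology max_topology \<Omega>) \<Gamma> diag_act \<and>
     (\<forall>U. openin (subtopology max_topology max_boundary) U \<and>
          properly_discontinuous (subtopology max_topology U) \<Gamma> diag_act \<longrightarrow> U \<subseteq> \<Omega>))"
proof -
  fix b :: 'a
  interpret quasi_convex_action \<Gamma> b using assms(1,2) by unfold_locales
  define \<Omega> where "\<Omega> = domain \<inter> max_boundary"
  have sub: "domain \<subseteq> topspace max_topology" using openin_domain by (rule openin_subset)
  have union: "max_product \<union> \<Omega> = domain"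
    using max_product_subset_domain sub by (auto simp: \<Omega>_def ideal_boundary_def topspace_horo_topology)
  show ?thesis
  proof (intro exI[of _ \<Omega>] conjI allI impI)
    show "openin (subtopology max_topology max_boundary) \<Omega>"
      unfolding \<Omega>_def by (rule openin_subtopology_Int[OF openin_domain])
    show "acts_on (subtopology max_topology (max_product \<union> \<Omega>)) \<Gamma> diag_act"
      using sub diag_act_domain by (simp add: union acts_on_def Int_absorb1)
    show "properly_discontinuous (subtopology max_topology (max_product \<union> \<Omega>)) \<Gamma> diag_act"
      unfolding union by (rule properly_discontinuous_domain)
    show "cocompact (subtopology max_topology (max_product \<union> \<Omega>)) \<Gamma> diag_act"
      unfolding union by (rule cocompact_domain)
    show "properly_discontinuous (subtopology max_topology \<Omega>) \<Gamma> diag_act"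
      using properly_discontinuous_domain unfolding properly_discontinuous_def compactin_subtopology \<Omega>_def
      by blast
    fix U assume U: "openin (subtopology max_topology max_boundary) U \<and>
          properly_discontinuous (subtopology max_topology U) \<Gamma> diag_act"
    then have "U \<subseteq> max_boundary" using openin_imp_subset by blast
    then show "U \<subseteq> \<Omega>"
      using properly_discontinuous_subset_domain[OF assms(3)] U by (auto simp: \<Omega>_def)
  qed
qed

end
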